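(* Let $A$ be an abelian group and let $G$ and $H$ be finite groups. Let $[\mathcal{S}_G]$ and $[\mathcal{S}_H]$ be sets of representatives of the conjugacy classes of subgroups of $G$ and of $H$, respectively. Assume that there is a bijection $\theta_{[\mathcal{S}]}\colon[\mathcal{S}_G]\to[\mathcal{S}_H]$ and, for each $K\in[\mathcal{S}_G]$, a group isomorphism $\theta_K\colon\mathrm{Hom}(K,A)\to\mathrm{Hom}(\theta_{[\mathcal{S}]}(K),A)$ such that $$\gamma^H_{(\theta_{[\mathcal{S}]}(K),\theta_K(\phi)),(\theta_{[\mathcal{S}]}(L),\theta_L(\psi))}=\gamma^G_{(K,\phi),(L,\psi)}$$ for all $K,L\in[\mathcal{S}_G]$, $\phi\in\mathrm{Hom}(K,A)$, $\psi\in\mathrm{Hom}(L,A)$. Then the assignment $[K,\phi]_G\mapsto[\theta_{[\mathcal{S}]}(K),\theta_K(\phi)]_H$ for $K\in[\mathcal{S}_G]$ and $\phi\in\mathrm{Hom}(K,A)$ extends to a species isomorphism $\Theta\colon B^A(G)\to B^A(H)$.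
   Context: Let $A$ be an abelian group (written multiplicatively) and $G$ a finite group. **Monomial pairs.** $\mathcal{M}^A_G$ is the set of pairs $(K,\phi)$ with $K\le G$ a subgroup and $\phi\colon K\to A$ a group homomorphism. $G$ acts on $\mathcal{M}^A_G$ by ${}^g(K,\phi)=({}^gK,{}^g\phi)$, where ${}^gK=gKg^{-1}$ and ${}^g\phi(x)=\phi(g^{-1}xg)$ for $x\in{}^gK$. The orbit of $(K,\phi)$ is denoted $[K,\phi]_G$, and $G\backslash\mathcal{M}^A_G$ is the set of orbits. One writes $(K,\phi)\le(L,\psi)$ if $K\le L$ and $\psi|_K=\phi$. $\mathrm{Hom}(K,A)$ is the group of homomorphisms $K\to A$ under pointwise multiplication. **Fibered Burnside ring.** The $A$-fibered Burnside ring $B^A(G)$ is the Grothendieck ring of the category of $A$-fibered $G$-sets ($G\times A$-sets that are free as $A$-sets with finitely many $A$-orbits), with addition from coproducts and multiplication from the tensor product $\otimes_A$. Concretely, it is the free abelian group with basis $G\backslash\mathcal{M}^A_G$ and commutative multiplication $$[K,\phi]_G\cdot[L,\psi]_G=\sum_{KsL\in K\backslash G/L}\bigl[K\cap{}^sL,\ \phi|_{K\cap{}^sL}\cdot{}^s\psi|_{K\cap{}^sL}\bigr]_G,$$ with identity $[G,1]_G$. **Species isomorphism.** For finite groups $G,H$, a ring isomorphism $\Theta\colon B^A(G)\to B^A(H)$ is a species isomorphism if $\Theta([K,\phi]_G)\in H\backslash\mathcal{M}^A_H$ (i.e. it is one of the standard basis elements $[R,\rho]_H$) for every $[K,\phi]_G\in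 G\backslash\mathcal{M}^A_G$. **The numbers $\gamma$.** For $(K,\phi),(L,\psi)\in\mathcal{M}^A_G$, $$\gamma^G_{(K,\phi),(L,\psi)}=\bigl|\{sL\in G/L : (K,\phi)\le{}^s(L,\psi)\}\bigr|.$$ The same notation is used for $H$. *)

theory Defs
  imports "HOL-Algebra.Free_Abelian_Groups" "HOL-Algebra.QuotRing" "HOL-Algebra.Group_Action"
begin

section \<open>Monomial pairs\<close>

text \<open>
  Homomorphisms are taken extensional (\<open>undefined\<close> outside \<open>K\<close>), so that two monomial pairs are
  equal as HOL values exactly when they agree as a subgroup with a map on it.
\<close>

definition Hom_set :: "('a, 'm) monoid_scheme \<Rightarrow> ('c, 'n) monoid_scheme \<Rightarrow> 'a set \<Rightarrow> ('a \<Rightarrow> 'c) set"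
  where "Hom_set G A K = hom (G\<lparr>carrier := K\<rparr>) A \<inter> extensional K"

definition Hom_group :: "('a, 'm) monoid_scheme \<Rightarrow> ('c, 'n) monoid_scheme \<Rightarrow> 'a set \<Rightarrow> ('a \<Rightarrow> 'c) monoid"
  where "Hom_group G A K =
    \<lparr>carrier = Hom_set G A K,
     monoid.mult = (\<lambda>\<phi> \<psi>. \<lambda>x\<in>K. \<phi> x \<otimes>\<^bsub>A\<^esub> \<psi> x),
     one = (\<lambda>x\<in>K. \<one>\<^bsub>A\<^esub>)\<rparr>"

definition mon_pairs :: "('a, 'm) monoid_scheme \<Rightarrow> ('c, 'n) monoid_scheme \<Rightarrow> ('a set \<times> ('a \<Rightarrow> 'c)) set"
  where "mon_pairs G A = {(K, \<phi>). subgroup K G \<and> \<phi> \<in> Hom_set G A K}"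

definition conj_set :: "('a, 'm) monoid_scheme \<Rightarrow> 'a \<Rightarrow> 'a set \<Rightarrow> 'a set"
  where "conj_set G g K = g <#\<^bsub>G\<^esub> K #>\<^bsub>G\<^esub> inv\<^bsub>G\<^esub> g"

definition mon_conj :: "('a, 'm) monoid_scheme \<Rightarrow> 'a \<Rightarrow> 'a set \<times> ('a \<Rightarrow> 'c) \<Rightarrow> 'a set \<times> ('a \<Rightarrow> 'c)"
  where "mon_conj G g = (\<lambda>(K, \<phi>).
    (conj_set G g K, \<lambda>x\<in>conj_set G g K. \<phi> (inv\<^bsub>G\<^esub> g \<otimes>\<^bsub>G\<^esub> x \<otimes>\<^bsub>G\<^esub> g)))"

definition mon_orbit :: "('a, 'm) monoid_scheme \<Rightarrow> 'a set \<times> ('a \<Rightarrow> 'c) \<Rightarrow> ('a set \<times> ('a \<Rightarrow> 'c)) set"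
  where "mon_orbit G p = (\<lambda>g. mon_conj G g p) ` carrier G"

definition mon_orbits :: "('a, 'm) monoid_scheme \<Rightarrow> ('c, 'n) monoid_scheme \<Rightarrow> ('a set \<times> ('a \<Rightarrow> 'c)) set set"
  where "mon_orbits G A = mon_orbit G ` mon_pairs G A"

definition mon_le :: "'a set \<times> ('a \<Rightarrow> 'c) \<Rightarrow> 'a set \<times> ('a \<Rightarrow> 'c) \<Rightarrow> bool"
  where "mon_le = (\<lambda>(K, \<phi>) (L, \<psi>). K \<subseteq> L \<and> restrict \<psi> K = \<phi>)"

text \<open>The condition depends only on the coset \<open>s <#\<^bsub>G\<^esub> L\<close>, not on \<open>s\<close>.\<close>

definition mon_gamma :: "('a, 'm) monoid_scheme \<Rightarrow> 'a set \<times> ('a \<Rightarrow> 'c) \<Rightarrow> 'a set \<times> ('a \<Rightarrow> 'c) \<Rightarrow> nat"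
  where "mon_gamma G p q = card {s <#\<^bsub>G\<^esub> fst q | s. s \<in> carrier G \<and> mon_le p (mon_conj G s q)}"

definition subgroup_class_reps :: "('a, 'm) monoid_scheme \<Rightarrow> 'a set set \<Rightarrow> bool"
  where "subgroup_class_reps G S \<longleftrightarrow>
    S \<subseteq> {K. subgroup K G} \<and>
    (\<forall>K. subgroup K G \<longrightarrow> (\<exists>!R. R \<in> S \<and> (\<exists>g\<in>carrier G. K = conj_set G g R)))"


section \<open>The \<open>A\<close>-fibered Burnside ring\<close>

definition mon_inter :: "('c, 'n) monoid_scheme \<Rightarrow> 'a set \<times> ('a \<Rightarrow> 'c) \<Rightarrow> 'a set \<times> ('a \<Rightarrow> 'c) \<Rightarrow> 'a set \<times> ('a \<Rightarrow> 'c)"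
  where "mon_inter A = (\<lambda>(K, \<phi>) (L, \<psi>). (K \<inter> L, \<lambda>x\<in>K \<inter> L. \<phi> x \<otimes>\<^bsub>A\<^esub> \<psi> x))"

definition double_cosets :: "('a, 'm) monoid_scheme \<Rightarrow> 'a set \<Rightarrow> 'a set \<Rightarrow> 'a set set"
  where "double_cosets G K L = {K <#>\<^bsub>G\<^esub> (s <#\<^bsub>G\<^esub> L) | s. s \<in> carrier G}"

text \<open>
  The product of two basis elements, with chosen representatives of the two orbits and of each
  double coset. Lemma \<open>burnside_mult_basis\<close> below shows that the choices do not matter.
\<close>

definition mon_prod ::
  "('a, 'm) monoid_scheme \<Rightarrow> ('c, 'n) monoid_scheme \<Rightarrow> 'a set \<times> ('a \<Rightarrow> 'c) \<Rightarrow> 'a set \<times> ('a \<Rightarrow> 'c)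
    \<Rightarrow> (('a set \<times> ('a \<Rightarrow> 'c)) set \<Rightarrow>\<^sub>0 int)"
  where "mon_prod G A p q =
    (\<Sum>D\<in>double_cosets G (fst p) (fst q).
       frag_of (mon_orbit G (mon_inter A p (mon_conj G (SOME s. s \<in> D) q))))"

definition orbit_prod ::
  "('a, 'm) monoid_scheme \<Rightarrow> ('c, 'n) monoid_scheme \<Rightarrow> ('a set \<times> ('a \<Rightarrow> 'c)) set \<Rightarrow> ('a set \<times> ('a \<Rightarrow> 'c)) set
    \<Rightarrow> (('a set \<times> ('a \<Rightarrow> 'c)) set \<Rightarrow>\<^sub>0 int)"
  where "orbit_prod G A U V = mon_prod G A (SOME p. p \<in> U) (SOME q. q \<in> V)"

definition burnside_ring ::
  "('c, 'n) monoid_scheme \<Rightarrow> ('a, 'm) monoid_scheme \<Rightarrow> (('a set \<times> ('a \<Rightarrow> 'c)) set \<Rightarrow>\<^sub>0 int) ring"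
  where "burnside_ring A G =
    \<lparr>carrier = carrier (free_Abelian_group (mon_orbits G A)),
     monoid.mult = (\<lambda>x y. frag_extend (\<lambda>U. frag_extend (\<lambda>V. orbit_prod G A U V) y) x),
     one = frag_of (mon_orbit G (carrier G, \<lambda>x\<in>carrier G. \<one>\<^bsub>A\<^esub>)),
     zero = 0,
     add = (+)\<rparr>"

definition species_iso ::
  "('c, 'n) monoid_scheme \<Rightarrow> ('a, 'm) monoid_scheme \<Rightarrow> ('b, 'k) monoid_scheme
    \<Rightarrow> ((('a set \<times> ('a \<Rightarrow> 'c)) set \<Rightarrow>\<^sub>0 int) \<Rightarrow> (('b set \<times> ('b \<Rightarrow> 'c)) set \<Rightarrow>\<^sub>0 int)) \<Rightarrow> bool"
  where "species_iso A G H \<Theta> \<longleftrightarrow>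
    \<Theta> \<in> ring_iso (burnside_ring A G) (burnside_ring A H) \<and>
    (\<forall>U\<in>mon_orbits G A. \<exists>V\<in>mon_orbits H A. \<Theta> (frag_of U) = frag_of V)"


section \<open>Independence of representatives\<close>

context group
begin

lemma conj_set_iff:
  assumes "K \<subseteq> carrier G" "g \<in> carrier G"
  shows "x \<in> conj_set G g K \<longleftrightarrow> x \<in> carrier G \<and> inv g \<otimes> x \<otimes> g \<in> K"
proof
  assume "x \<in> conj_set G g K"
  then obtain k where k: "k \<in> K" "x = g \<otimes> k \<otimes> inv g"
    by (auto simp: conj_set_def l_coset_def r_coset_def)
  have kc: "k \<in> carrier G" using k assms by auto
  have "inv g \<otimes> x \<otimes> g = k"
    using kc assms(2) by (simp add: k(2) m_assoc) (simp add: m_assoc [symmetric])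
  then show "x \<in> carrier G \<and> inv g \<otimes> x \<otimes> g \<in> K"
    using k kc assms by simp
next
  assume a: "x \<in> carrier G \<and> inv g \<otimes> x \<otimes> g \<in> K"
  have "x = g \<otimes> (inv g \<otimes> x \<otimes> g) \<otimes> inv g"
    using a assms(2) by (simp add: m_assoc) (simp add: m_assoc [symmetric])
  then show "x \<in> conj_set G g K"
    using a by (auto simp: conj_set_def l_coset_def r_coset_def)
qed

lemma conj_set_carrier: "K \<subseteq> carrier G \<Longrightarrow> g \<in> carrier G \<Longrightarrow> conj_set G g K \<subseteq> carrier G"
  using conj_set_iff by auto

lemma fst_mon_conj: "fst (mon_conj G g p) = conj_set G g (fst p)"
  by (simp add: mon_conj_def split: prod.splits)

lemma mon_conj_mult:
  assumes "fst p \<subseteq> carrier G" "g \<in> carrier G" "h \<in> carrier G"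
  shows "mon_conj G g (mon_conj G h p) = mon_conj G (g \<otimes> h) p"
proof -
  obtain K \<phi> where p: "p = (K, \<phi>)" by force
  have K: "K \<subseteq> carrier G" using assms p by simp
  have e: "inv h \<otimes> (inv g \<otimes> x \<otimes> g) \<otimes> h = inv (g \<otimes> h) \<otimes> x \<otimes> (g \<otimes> h)" if "x \<in> carrier G" for x
    using that assms by (simp add: m_assoc inv_mult_group)
  have s: "conj_set G g (conj_set G h K) = conj_set G (g \<otimes> h) K"
    using K assms by (auto simp: conj_set_iff conj_set_carrier e)
  have "(\<lambda>x\<in>conj_set G g (conj_set G h K).
          (\<lambda>y\<in>conj_set G h K. \<phi> (inv h \<otimes> y \<otimes> h)) (inv g \<otimes> x \<otimes> g)) =
        (\<lambda>x\<in>conj_set G g (conj_set G h K). \<phi> (inv (g \<otimes> h) \<otimes> x \<otimes> (g \<otimes> h)))"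
    by (rule restrict_ext)
       (use K assms in \<open>auto simp: conj_set_iff [OF conj_set_carrier] e\<close>)
  then show ?thesis by (simp add: p mon_conj_def s)
qed

lemma mon_conj_fixed:
  assumes A: "comm_group A" and p: "p \<in> mon_pairs G A" and k: "k \<in> fst p"
  shows "mon_conj G k p = p"
proof -
  obtain K \<phi> where pe: "p = (K, \<phi>)" by force
  have K: "subgroup K G" and h: "\<phi> \<in> hom (G\<lparr>carrier := K\<rparr>) A" and e: "\<phi> \<in> extensional K"
    using p by (auto simp: pe mon_pairs_def Hom_set_def)
  interpret A: comm_group A by fact
  have kK: "k \<in> K" using k pe by simp
  have kc: "k \<in> carrier G" using K kK by (rule subgroup.mem_carrier)
  have Kc: "K \<subseteq> carrier G" using K by (rule subgroup.subset)
  have s: "conj_set G k K = K"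
  proof (rule Set.set_eqI)
    fix x
    have "x \<in> K" if "x \<in> carrier G" "inv k \<otimes> x \<otimes> k \<in> K"
    proof -
      have "x = k \<otimes> (inv k \<otimes> x \<otimes> k) \<otimes> inv k"
        using that kc by (simp add: m_assoc) (simp add: m_assoc [symmetric])
      then show ?thesis
        using that kK subgroup.m_closed [OF K] subgroup.m_inv_closed [OF K] by metis
    qed
    then show "x \<in> conj_set G k K \<longleftrightarrow> x \<in> K"
      using K kK kc Kc by (auto simp: conj_set_iff subgroup.m_closed subgroup.m_inv_closed)
  qed
  have "\<phi> (inv k \<otimes> x \<otimes> k) = \<phi> x" if x: "x \<in> K" for x
  proof -
    have ik: "inv k \<in> K" using K kK by (rule subgroup.m_inv_closed)
    have m: "\<phi> (a \<otimes> b) = \<phi> a \<otimes>\<^bsub>A\<^esub> \<phi> b" if "a \<in> K" "b \<in> K" for a b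
      using h that by (auto simp: hom_def)
    have c: "\<phi> a \<in> carrier A" if "a \<in> K" for a using h that by (auto simp: hom_def)
    have xc: "x \<in> carrier G" using x Kc by auto
    have "\<phi> (inv k \<otimes> x \<otimes> k) = \<phi> (inv k \<otimes> x) \<otimes>\<^bsub>A\<^esub> \<phi> k"
      using ik x kK K by (simp add: m subgroup.m_closed)
    also have "\<dots> = \<phi> k \<otimes>\<^bsub>A\<^esub> \<phi> (inv k \<otimes> x)"
      using ik x kK K by (simp add: c A.m_comm subgroup.m_closed)
    also have "\<dots> = \<phi> (k \<otimes> (inv k \<otimes> x))"
      using ik x kK K by (simp add: m subgroup.m_closed)
    also have "k \<otimes> (inv k \<otimes> x) = x"
      using kc xc by (simp add: m_assoc [symmetric])
    finally show ?thesis .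
  qed
  then have "(\<lambda>x\<in>K. \<phi> (inv k \<otimes> x \<otimes> k)) = \<phi>"
    using e by (auto simp: fun_eq_iff extensional_def)
  then show ?thesis by (simp add: pe mon_conj_def s)
qed

lemma mon_conj_inter:
  assumes "fst p \<subseteq> carrier G" "fst q \<subseteq> carrier G" "g \<in> carrier G"
  shows "mon_conj G g (mon_inter A p q) = mon_inter A (mon_conj G g p) (mon_conj G g q)"
proof -
  obtain K \<phi> L \<psi> where pq: "p = (K, \<phi>)" "q = (L, \<psi>)" by (metis surj_pair)
  have KL: "K \<subseteq> carrier G" "L \<subseteq> carrier G" "K \<inter> L \<subseteq> carrier G" using assms pq by auto
  have s: "conj_set G g (K \<inter> L) = conj_set G g K \<inter> conj_set G g L"
    using KL assms(3) by (auto simp: conj_set_iff)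
  show ?thesis
    using KL assms(3)
    by (auto simp: pq mon_conj_def mon_inter_def s conj_set_iff intro!: restrict_ext)
qed

lemma mon_orbit_conj:
  assumes "fst p \<subseteq> carrier G" "g \<in> carrier G"
  shows "mon_orbit G (mon_conj G g p) = mon_orbit G p"
proof -
  have "mon_conj G h p \<in> mon_orbit G (mon_conj G g p)" if h: "h \<in> carrier G" for h
  proof -
    have "mon_conj G h p = mon_conj G (h \<otimes> inv g) (mon_conj G g p)"
      using h assms by (simp add: mon_conj_mult m_assoc)
    then show ?thesis using h assms by (auto simp: mon_orbit_def)
  qed
  then show ?thesis
    using assms by (auto simp: mon_orbit_def mon_conj_mult)
qed

lemma mon_orbit_refl:
  assumes "comm_group A" "p \<in> mon_pairs G A"
  shows "p \<in> mon_orbit G p"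
proof -
  have "subgroup (fst p) G" using assms(2) by (auto simp: mon_pairs_def)
  then have "mon_conj G \<one> p = p"
    using assms by (intro mon_conj_fixed) (auto intro: subgroup.one_closed)
  then show ?thesis unfolding mon_orbit_def by (metis image_eqI one_closed)
qed

lemma mem_double_coset:
  "x \<in> K <#> (s <# L) \<longleftrightarrow> (\<exists>k\<in>K. \<exists>l\<in>L. x = k \<otimes> (s \<otimes> l))"
  by (auto simp: set_mult_def l_coset_def)

lemma double_coset_eq:
  assumes K: "subgroup K G" and L: "subgroup L G" and s: "s \<in> carrier G"
    and t: "t \<in> K <#> (s <# L)"
  shows "K <#> (t <# L) = K <#> (s <# L)"
proof -
  have sub: "K <#> (t <# L) \<subseteq> K <#> (s <# L)"
    if s: "s \<in> carrier G" and t: "t \<in> K <#> (s <# L)" for s t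
  proof
    fix x assume "x \<in> K <#> (t <# L)"
    then obtain k l where kl: "k \<in> K" "l \<in> L" "x = k \<otimes> (t \<otimes> l)" by (auto simp: mem_double_coset)
    obtain k' l' where kl': "k' \<in> K" "l' \<in> L" "t = k' \<otimes> (s \<otimes> l')" using t by (auto simp: mem_double_coset)
    have c: "k \<in> carrier G" "k' \<in> carrier G" "l \<in> carrier G" "l' \<in> carrier G"
      using kl kl' subgroup.mem_carrier [OF K] subgroup.mem_carrier [OF L] by auto
    have "x = (k \<otimes> k') \<otimes> (s \<otimes> (l' \<otimes> l))" using c s by (simp add: kl kl' m_assoc)
    moreover have "k \<otimes> k' \<in> K" "l' \<otimes> l \<in> L" using kl kl' K L by (auto intro: subgroup.m_closed)
    ultimately show "x \<in> K <#> (s <# L)" by (auto simp: mem_double_coset)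
  qed
  obtain k l where kl: "k \<in> K" "l \<in> L" "t = k \<otimes> (s \<otimes> l)" using t by (auto simp: mem_double_coset)
  have c: "k \<in> carrier G" "l \<in> carrier G" using kl subgroup.mem_carrier [OF K] subgroup.mem_carrier [OF L] by auto
  have tc: "t \<in> carrier G" using c s kl by simp
  have "inv k \<otimes> (t \<otimes> inv l) = s"
    using c s by (simp add: kl m_assoc) (simp add: m_assoc [symmetric])
  moreover have "inv k \<in> K" "inv l \<in> L" using kl K L by (auto intro: subgroup.m_inv_closed)
  ultimately have "s \<in> K <#> (t <# L)" by (metis mem_double_coset)
  then show ?thesis using sub [OF s t] sub [OF tc] by blast
qed

lemma double_coset_ne:
  assumes "subgroup K G" "subgroup L G" "s \<in> carrier G"
  shows "s \<in> K <#> (s <# L)"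
  using assms by (force simp: mem_double_coset dest: subgroup.one_closed)

lemma mon_prod_independent:
  assumes A: "comm_group A" and p: "p \<in> mon_pairs G A" and q: "q \<in> mon_pairs G A"
    and D: "D \<in> double_cosets G (fst p) (fst q)" and s: "s \<in> D" and t: "t \<in> D"
  shows "mon_orbit G (mon_inter A p (mon_conj G s q)) = mon_orbit G (mon_inter A p (mon_conj G t q))"
proof -
  have Ks: "subgroup (fst p) G" "subgroup (fst q) G" using p q by (auto simp: mon_pairs_def)
  then have Kc: "fst p \<subseteq> carrier G" "fst q \<subseteq> carrier G" by (auto dest: subgroup.subset)
  obtain d where d: "d \<in> carrier G" "D = fst p <#> (d <# fst q)"
    using D by (auto simp: double_cosets_def)
  have main: "mon_orbit G (mon_inter A p (mon_conj G s q)) = mon_orbit G (mon_inter A p (mon_conj G d q))"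
    if s: "s \<in> D" for s
  proof -
    obtain k l where kl: "k \<in> fst p" "l \<in> fst q" "s = k \<otimes> (d \<otimes> l)"
      using s d by (auto simp: mem_double_coset)
    have c: "k \<in> carrier G" "l \<in> carrier G" using kl Kc by auto
    have fq: "fst (mon_conj G d q) \<subseteq> carrier G"
      using conj_set_carrier [OF Kc(2) d(1)] by (simp add: fst_mon_conj)
    have ic: "fst (mon_inter A p (mon_conj G d q)) \<subseteq> carrier G"
      using Kc by (auto simp: mon_inter_def split: prod.splits)
    have "mon_conj G s q = mon_conj G k (mon_conj G d (mon_conj G l q))"
      using c d Kc kl mon_conj_fixed [OF A q kl(2)] by (metis m_closed mon_conj_mult)
    also have "\<dots> = mon_conj G k (mon_conj G d q)"
      using mon_conj_fixed [OF A q kl(2)] by simp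
    finally have "mon_inter A p (mon_conj G s q) = mon_conj G k (mon_inter A p (mon_conj G d q))"
      using mon_conj_inter [OF Kc(1) fq c(1), of A] mon_conj_fixed [OF A p kl(1)] by simp
    then show ?thesis using mon_orbit_conj [OF ic c(1)] by simp
  qed
  show ?thesis using main [OF s] main [OF t] by simp
qed

lemma mon_prod_reps:
  assumes A: "comm_group A" and p: "p \<in> mon_pairs G A" and q: "q \<in> mon_pairs G A"
    and r: "\<And>D. D \<in> double_cosets G (fst p) (fst q) \<Longrightarrow> r D \<in> D"
  shows "mon_prod G A p q =
    (\<Sum>D\<in>double_cosets G (fst p) (fst q). frag_of (mon_orbit G (mon_inter A p (mon_conj G (r D) q))))"
  unfolding mon_prod_def
proof (rule sum.cong [OF refl])
  fix D assume D: "D \<in> double_cosets G (fst p) (fst q)"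
  have "(SOME s. s \<in> D) \<in> D" using r [OF D] by (rule someI)
  then show "frag_of (mon_orbit G (mon_inter A p (mon_conj G (SOME s. s \<in> D) q))) =
             frag_of (mon_orbit G (mon_inter A p (mon_conj G (r D) q)))"
    using mon_prod_independent [OF A p q D _ r [OF D]] by simp
qed

lemma mon_conj_pairs:
  assumes p: "p \<in> mon_pairs G A" and g: "g \<in> carrier G"
  shows "mon_conj G g p \<in> mon_pairs G A"
proof -
  obtain K \<phi> where pe: "p = (K, \<phi>)" by force
  have K: "subgroup K G" and h: "\<phi> \<in> hom (G\<lparr>carrier := K\<rparr>) A"
    using p by (auto simp: pe mon_pairs_def Hom_set_def)
  have Kc: "K \<subseteq> carrier G" using K by (rule subgroup.subset)
  have e: "inv g \<otimes> (x \<otimes> y) \<otimes> g = (inv g \<otimes> x \<otimes> g) \<otimes> (inv g \<otimes> y \<otimes> g)"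
    if "x \<in> carrier G" "y \<in> carrier G" for x y
  proof -
    have "g \<otimes> (inv g \<otimes> (y \<otimes> g)) = y \<otimes> g" using that g by (simp add: m_assoc [symmetric])
    then show ?thesis using that g by (simp add: m_assoc)
  qed
  have s: "subgroup (conj_set G g K) G"
    using subgroup_conjugation_is_surj2 [of g K] K g by (simp add: conj_set_def)
  have "(\<lambda>x\<in>conj_set G g K. \<phi> (inv g \<otimes> x \<otimes> g)) \<in> Hom_set G A (conj_set G g K)"
    using h s Kc g by (auto simp: Hom_set_def hom_def conj_set_iff e subgroup.m_closed [OF K])
  then show ?thesis using s by (simp add: pe mon_pairs_def mon_conj_def)
qed

lemma double_coset_conj:
  assumes "K \<subseteq> carrier G" "L \<subseteq> carrier G" "s \<in> carrier G" "g \<in> carrier G" "h \<in> carrier G"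
  shows "conj_set G g K <#> ((g \<otimes> s \<otimes> inv h) <# conj_set G h L) = (g <# (K <#> (s <# L))) #> inv h"
proof -
  have c: "g \<otimes> k \<otimes> inv g \<otimes> (g \<otimes> s \<otimes> inv h \<otimes> (h \<otimes> l \<otimes> inv h)) = g \<otimes> (k \<otimes> (s \<otimes> l)) \<otimes> inv h"
    if "k \<in> K" "l \<in> L" for k l
  proof -
    have kl: "k \<in> carrier G" "l \<in> carrier G" using that assms by auto
    have "inv g \<otimes> (g \<otimes> x) = x" "inv h \<otimes> (h \<otimes> x) = x" if "x \<in> carrier G" for x
      using that assms by (simp_all add: m_assoc [symmetric])
    then show ?thesis using kl assms by (simp add: m_assoc)
  qed
  have cs: "conj_set G g M = (\<lambda>k. g \<otimes> k \<otimes> inv g) ` M" for g M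
    by (auto simp: conj_set_def l_coset_def r_coset_def)
  have "conj_set G g K <#> ((g \<otimes> s \<otimes> inv h) <# conj_set G h L)
      = {g \<otimes> k \<otimes> inv g \<otimes> (g \<otimes> s \<otimes> inv h \<otimes> (h \<otimes> l \<otimes> inv h)) | k l. k \<in> K \<and> l \<in> L}"
    by (auto simp: set_mult_def l_coset_def cs)
  also have "\<dots> = {g \<otimes> (k \<otimes> (s \<otimes> l)) \<otimes> inv h | k l. k \<in> K \<and> l \<in> L}"
    using c by (intro Collect_cong) metis
  also have "\<dots> = (g <# (K <#> (s <# L))) #> inv h"
    by (auto simp: set_mult_def l_coset_def r_coset_def)
  finally show ?thesis .
qed

lemma mon_prod_conj:
  assumes A: "comm_group A" and p: "p \<in> mon_pairs G A" and q: "q \<in> mon_pairs G A"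
    and g: "g \<in> carrier G" and h: "h \<in> carrier G"
  shows "mon_prod G A (mon_conj G g p) (mon_conj G h q) = mon_prod G A p q"
proof -
  let ?K = "fst p" and ?L = "fst q"
  have KL: "subgroup ?K G" "subgroup ?L G" using p q by (auto simp: mon_pairs_def)
  then have Kc: "?K \<subseteq> carrier G" "?L \<subseteq> carrier G" by (auto dest: subgroup.subset)
  define T where "T D = (g <# D) #> inv h" for D
  have Dc: "D \<subseteq> carrier G" if "D \<in> double_cosets G ?K ?L" for D
    using that Kc by (auto simp: double_cosets_def mem_double_coset subset_iff)
  have Timg: "T D = (\<lambda>x. g \<otimes> x \<otimes> inv h) ` D" for D
    by (auto simp: T_def l_coset_def r_coset_def)
  have inj: "inj_on T (double_cosets G ?K ?L)"
  proof (rule inj_on_inverseI)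
    fix D assume "D \<in> double_cosets G ?K ?L"
    then have D: "D \<subseteq> carrier G" by (rule Dc)
    have "inv g \<otimes> (g \<otimes> x \<otimes> inv h) \<otimes> h = x" if "x \<in> D" for x
    proof -
      have "x \<in> carrier G" using that D by auto
      then show ?thesis using g h by (simp add: m_assoc) (simp add: m_assoc [symmetric])
    qed
    then show "(\<lambda>E. (\<lambda>x. inv g \<otimes> x \<otimes> h) ` E) (T D) = D"
      by (auto simp: Timg image_image)
  qed
  have img: "double_cosets G (conj_set G g ?K) (conj_set G h ?L) = T ` double_cosets G ?K ?L"
  proof -
    have "\<exists>s\<in>carrier G. t = g \<otimes> s \<otimes> inv h" if t: "t \<in> carrier G" for t
    proof
      show "t = g \<otimes> (inv g \<otimes> t \<otimes> h) \<otimes> inv h"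
        using t g h by (simp add: m_assoc) (simp add: m_assoc [symmetric])
      show "inv g \<otimes> t \<otimes> h \<in> carrier G" using t g h by simp
    qed
    then have "carrier G = (\<lambda>s. g \<otimes> s \<otimes> inv h) ` carrier G" using g h by auto
    then have "double_cosets G (conj_set G g ?K) (conj_set G h ?L) =
        (\<lambda>t. conj_set G g ?K <#> (t <# conj_set G h ?L)) ` ((\<lambda>s. g \<otimes> s \<otimes> inv h) ` carrier G)"
      unfolding double_cosets_def by (metis Setcompr_eq_image)
    also have "\<dots> = (\<lambda>s. T (?K <#> (s <# ?L))) ` carrier G"
      unfolding image_image T_def by (rule image_cong [OF refl]) (rule double_coset_conj [OF Kc _ g h])
    also have "\<dots> = T ` double_cosets G ?K ?L"
      by (auto simp: double_cosets_def)
    finally show ?thesis .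
  qed
  have some: "(SOME s. s \<in> D) \<in> D" if "D \<in> double_cosets G ?K ?L" for D
  proof -
    have "\<exists>s. s \<in> D" using that double_coset_ne [OF KL] by (auto simp: double_cosets_def)
    then show ?thesis by (rule someI_ex)
  qed
  have invT: "inv_into (double_cosets G ?K ?L) T (T D) = D" if "D \<in> double_cosets G ?K ?L" for D
    using inj that by (rule inv_into_f_f)
  define r where "r E = g \<otimes> (SOME s. s \<in> inv_into (double_cosets G ?K ?L) T E) \<otimes> inv h" for E
  have r: "r (T D) = g \<otimes> (SOME s. s \<in> D) \<otimes> inv h" if "D \<in> double_cosets G ?K ?L" for D
    using invT [OF that] by (simp add: r_def)
  have rT: "r E \<in> E" if "E \<in> T ` double_cosets G ?K ?L" for E
    using that some by (auto simp: r) (simp add: Timg)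
  have "mon_prod G A (mon_conj G g p) (mon_conj G h q) =
    (\<Sum>E\<in>T ` double_cosets G ?K ?L.
      frag_of (mon_orbit G (mon_inter A (mon_conj G g p) (mon_conj G (r E) (mon_conj G h q)))))"
    using mon_prod_reps [OF A mon_conj_pairs [OF p g] mon_conj_pairs [OF q h], of r] rT
    by (simp add: fst_mon_conj img)
  also have "\<dots> = (\<Sum>D\<in>double_cosets G ?K ?L.
      frag_of (mon_orbit G (mon_inter A (mon_conj G g p) (mon_conj G (r (T D)) (mon_conj G h q)))))"
    using inj by (simp add: sum.reindex)
  also have "\<dots> = mon_prod G A p q"
    unfolding mon_prod_def
  proof (rule sum.cong [OF refl])
    fix D assume D: "D \<in> double_cosets G ?K ?L"
    let ?s = "SOME s. s \<in> D"
    have s: "?s \<in> carrier G" using some [OF D] Dc [OF D] by auto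
    have fq: "fst (mon_conj G ?s q) \<subseteq> carrier G"
      using conj_set_carrier [OF Kc(2) s] by (simp add: fst_mon_conj)
    have ic: "fst (mon_inter A p (mon_conj G ?s q)) \<subseteq> carrier G"
      using Kc by (auto simp: mon_inter_def split: prod.splits)
    have "mon_conj G (r (T D)) (mon_conj G h q) = mon_conj G g (mon_conj G ?s q)"
      using s g h Kc by (simp add: r [OF D] mon_conj_mult m_assoc)
    then have "mon_inter A (mon_conj G g p) (mon_conj G (r (T D)) (mon_conj G h q)) =
        mon_conj G g (mon_inter A p (mon_conj G ?s q))"
      using mon_conj_inter [OF Kc(1) fq g, of A] by simp
    then show "frag_of (mon_orbit G (mon_inter A (mon_conj G g p) (mon_conj G (r (T D)) (mon_conj G h q)))) =
        frag_of (mon_orbit G (mon_inter A p (mon_conj G ?s q)))"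
      using mon_orbit_conj [OF ic g] by simp
  qed
  finally show ?thesis .
qed

lemma burnside_mult_basis:
  assumes A: "comm_group A" and p: "p \<in> mon_pairs G A" and q: "q \<in> mon_pairs G A"
    and r: "\<And>D. D \<in> double_cosets G (fst p) (fst q) \<Longrightarrow> r D \<in> D"
  shows "frag_of (mon_orbit G p) \<otimes>\<^bsub>burnside_ring A G\<^esub> frag_of (mon_orbit G q) =
    (\<Sum>D\<in>double_cosets G (fst p) (fst q). frag_of (mon_orbit G (mon_inter A p (mon_conj G (r D) q))))"
proof -
  have "\<exists>g\<in>carrier G. (SOME x. x \<in> mon_orbit G p) = mon_conj G g p"
    if "p \<in> mon_pairs G A" for p
    using someI [of "\<lambda>x. x \<in> mon_orbit G p", OF mon_orbit_refl [OF A that]]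
    by (auto simp: mon_orbit_def)
  then obtain g h where "g \<in> carrier G" "(SOME x. x \<in> mon_orbit G p) = mon_conj G g p"
    "h \<in> carrier G" "(SOME x. x \<in> mon_orbit G q) = mon_conj G h q"
    using p q by meson
  then have "orbit_prod G A (mon_orbit G p) (mon_orbit G q) = mon_prod G A p q"
    using mon_prod_conj [OF A p q] by (simp add: orbit_prod_def)
  moreover have "frag_of (mon_orbit G p) \<otimes>\<^bsub>burnside_ring A G\<^esub> frag_of (mon_orbit G q) =
      orbit_prod G A (mon_orbit G p) (mon_orbit G q)"
    by (simp add: burnside_ring_def)
  moreover have "mon_prod G A p q =
      (\<Sum>D\<in>double_cosets G (fst p) (fst q). frag_of (mon_orbit G (mon_inter A p (mon_conj G (r D) q))))"
    by (rule mon_prod_reps [OF A p q]) (rule r)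
  ultimately show ?thesis by simp
qed

end

end

theory Submission
  imports Defs "HOL-Algebra.Left_Coset"
begin

text \<open>
  For a subgroup \<open>K\<close> of \<open>G\<close> send the basis element \<open>[L, \<psi>]\<close> of the fibered Burnside ring to its
  \<^emph>\<open>ghost\<close> \<open>\<Sum>\<phi>. \<gamma>((K, \<phi>), (L, \<psi>)) \<phi>\<close> in the integral group ring of \<open>Hom(K, A)\<close>, and extend
  linearly. The sum is finite: only the homomorphisms \<open>\<^sup>s\<psi>\<close> restricted to \<open>K\<close> contribute. Three
  facts about the ghosts prove the theorem.

  \<^item> Each ghost map is multiplicative (\<open>ghost_map_mult\<close>). Multiplied by \<open>card L\<close>, the ghost of
    \<open>[L, \<psi>]\<close> is the sum of \<open>\<^sup>s\<psi>\<close> restricted to \<open>K\<close>, over all \<open>s\<close> in \<open>G\<close> with \<open>K \<le> \<^sup>sL\<close>. So the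
    product of the ghosts of \<open>[L, \<psi>]\<close> and \<open>[M, \<chi>]\<close>, multiplied by \<open>card L * card M\<close>, is a sum over
    pairs \<open>(s, t)\<close> of elements of \<open>G\<close>. Writing \<open>t = s \<otimes> d\<close> and collecting the \<open>d\<close> in one double coset
    \<open>L d M\<close>, which has \<open>card L * card M / card (L \<inter> \<^sup>dM)\<close> elements, gives the ghost of the product,
    multiplied by the same factor (\<open>ghost_mon_prod\<close>).

  \<^item> An element of the ring all of whose ghosts vanish is zero (\<open>ghost_map_jointly_injective\<close>),
    since the matrix of the numbers \<open>\<gamma>\<close> is triangular with respect to the order of subgroups and has
    non-zero diagonal.

  \<^item> The numbers \<open>\<gamma>\<close> decide conjugacy: two monomial pairs are conjugate if and only if \<open>\<gamma>\<close> is
    non-zero on them in both orders (\<open>mon_orbit_eq_iff_gamma\<close>).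

  By the last fact the given assignment is a well-defined bijection between the two bases. Its
  linear extension \<open>\<Theta>\<close> carries the ghost of \<open>x\<close> at \<open>K\<close> to the ghost of \<open>\<Theta> x\<close> at \<open>\<theta>S K\<close>, by means of
  the isomorphism \<open>\<theta> K\<close>, because the numbers \<open>\<gamma>\<close> agree. Hence \<open>\<Theta> (x y)\<close> and \<open>\<Theta> x \<Theta> y\<close> have
  the same ghosts, and they are equal; the same argument applies to the identity.
\<close>

section \<open>Convolution of formal integer combinations\<close>

text \<open>
  The multiplication of the integral monoid ring of \<open>M\<close>, on finitely supported integer functions.
  It is stated for functions on the whole type; only those supported in \<open>carrier M\<close> are meaningful.
\<close>

definition conv :: "('a, 'm) monoid_scheme \<Rightarrow> ('a \<Rightarrow>\<^sub>0 int) \<Rightarrow> ('a \<Rightarrow>\<^sub>0 int) \<Rightarrow> ('a \<Rightarrow>\<^sub>0 int)"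
  where "conv M x y = frag_extend (\<lambda>a. frag_extend (\<lambda>b. frag_of (a \<otimes>\<^bsub>M\<^esub> b)) y) x"

lemma lookup_frag_extend:
  "Poly_Mapping.lookup (frag_extend f x) k =
     (\<Sum>i\<in>Poly_Mapping.keys x. Poly_Mapping.lookup x i * Poly_Mapping.lookup (f i) k)"
  by (simp add: frag_extend_def lookup_sum)

lemma frag_extend_fun_cmul: "frag_extend (\<lambda>a. frag_cmul c (f a)) x = frag_cmul c (frag_extend f x)"
  by (rule poly_mapping_eqI) (simp add: lookup_frag_extend sum_distrib_left algebra_simps)

lemma frag_extend_fun_diff: "frag_extend (\<lambda>a. f a - g a) x = frag_extend f x - frag_extend g x"
  by (rule poly_mapping_eqI) (simp add: lookup_frag_extend lookup_minus algebra_simps sum_subtractf)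

lemma frag_extend_extend:
  "frag_extend f (frag_extend g x) = frag_extend (\<lambda>a. frag_extend f (g a)) x"
  using subset_UNIV by (induction x rule: frag_induction) (auto simp: frag_extend_diff)

lemma conv_extend_left: "conv M (frag_extend g x) y = frag_extend (\<lambda>a. conv M (g a) y) x"
  by (simp add: conv_def frag_extend_extend)

lemma conv_diff_right: "conv M x (y - z) = conv M x y - conv M x z"
  by (simp add: conv_def frag_extend_diff frag_extend_fun_diff)

lemma conv_extend_right: "conv M x (frag_extend g y) = frag_extend (\<lambda>a. conv M x (g a)) y"
  using subset_UNIV
  by (induction y rule: frag_induction)
     (auto simp: frag_extend_diff conv_diff_right, simp add: conv_def frag_extend_eq_0)

lemma conv_cmul: "conv M (frag_cmul c x) (frag_cmul d y) = frag_cmul (c * d) (conv M x y)"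
  by (simp add: conv_def frag_extend_cmul frag_extend_fun_cmul mult.commute)

lemma conv_sum_frag_of:
  assumes "finite I" "finite J"
  shows "conv M (\<Sum>i\<in>I. frag_of (f i)) (\<Sum>j\<in>J. frag_of (g j)) =
    (\<Sum>i\<in>I. \<Sum>j\<in>J. frag_of (f i \<otimes>\<^bsub>M\<^esub> g j))"
  using assms by (simp add: conv_def frag_extend_sum)

lemma conv_image:
  assumes x: "Poly_Mapping.keys x \<subseteq> carrier M" and y: "Poly_Mapping.keys y \<subseteq> carrier M"
    and h: "\<And>a b. a \<in> carrier M \<Longrightarrow> b \<in> carrier M \<Longrightarrow> h (a \<otimes>\<^bsub>M\<^esub> b) = h a \<otimes>\<^bsub>N\<^esub> h b"
  shows "frag_extend (\<lambda>a. frag_of (h a)) (conv M x y) =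
    conv N (frag_extend (\<lambda>a. frag_of (h a)) x) (frag_extend (\<lambda>a. frag_of (h a)) y)"
proof -
  have "frag_extend (\<lambda>a. frag_extend (\<lambda>b. frag_of (h (a \<otimes>\<^bsub>M\<^esub> b))) y) x =
        frag_extend (\<lambda>a. frag_extend (\<lambda>b. frag_of (h a \<otimes>\<^bsub>N\<^esub> h b)) y) x"
    using x y h by (intro frag_extend_eq) (metis subsetD)
  then show ?thesis by (simp add: conv_def frag_extend_extend)
qed

lemma lookup_frag_extend_inj:
  assumes "inj_on h S" "Poly_Mapping.keys x \<subseteq> S" "a \<in> S"
  shows "Poly_Mapping.lookup (frag_extend (\<lambda>a. frag_of (h a)) x) (h a) = Poly_Mapping.lookup x a"
proof -
  have "Poly_Mapping.lookup (frag_extend (\<lambda>a. frag_of (h a)) x) (h a) =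
     (\<Sum>i\<in>Poly_Mapping.keys x. if i = a then Poly_Mapping.lookup x i else 0)"
    unfolding lookup_frag_extend
    using assms by (intro sum.cong) (auto dest: inj_onD)
  then show ?thesis by (simp add: in_keys_iff)
qed

lemma sum_const_frag: "(\<Sum>i\<in>I. x) = frag_cmul (int (card I)) x"
  by (rule poly_mapping_eqI) (simp add: lookup_sum)

lemma frag_cmul_cancel: "c \<noteq> 0 \<Longrightarrow> frag_cmul c x = frag_cmul c y \<Longrightarrow> x = y"
  by (auto intro!: poly_mapping_eqI simp: poly_mapping_eq_iff fun_eq_iff)

section \<open>Counting in cosets and double cosets\<close>

context group
begin

lemma inv_cancel:
  assumes "x \<in> carrier G" "y \<in> carrier G"
  shows "inv x \<otimes> (x \<otimes> y) = y" "x \<otimes> (inv x \<otimes> y) = y"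
  using assms by (simp_all add: m_assoc [symmetric])

lemma card_conj_set:
  assumes "K \<subseteq> carrier G" "g \<in> carrier G"
  shows "card (conj_set G g K) = card K"
proof -
  have eq: "conj_set G g K = (\<lambda>k. g \<otimes> k \<otimes> inv g) ` K"
    by (auto simp: conj_set_def l_coset_def r_coset_def)
  have "inj_on (\<lambda>k. g \<otimes> k \<otimes> inv g) K"
    using assms by (intro inj_onI) (auto simp: subset_iff)
  then show ?thesis by (simp add: eq card_image)
qed

text \<open>A set closed under right multiplication by \<open>L\<close> is a disjoint union of left cosets, all of size \<open>card L\<close>.\<close>

lemma card_union_of_cosets:
  assumes fin_G: "finite (carrier G)" and L: "subgroup L G" and S: "S \<subseteq> carrier G"
    and closed: "\<And>s t. s \<in> S \<Longrightarrow> t \<in> s <# L \<Longrightarrow> t \<in> S"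
  shows "card S = card L * card ((\<lambda>s. s <# L) ` S)"
proof -
  have fin: "finite S" using S fin_G by (rule finite_subset)
  have fibre: "{t \<in> S. t <# L = s <# L} = s <# L" if s: "s \<in> S" for s
  proof -
    have "t \<in> s <# L" if "t \<in> S" "t <# L = s <# L" for t
      using that lcos_self [OF _ L, of t] S by auto
    moreover have "t <# L = s <# L" if "t \<in> s <# L" for t
      using l_repr_independence [OF that _ L] s S by auto
    ultimately show ?thesis using closed [OF s] by blast
  qed
  have "card S = (\<Sum>C\<in>(\<lambda>s. s <# L) ` S. card {t \<in> S. t <# L = C})"
    using sum.image_gen [OF fin, of "\<lambda>_. 1::nat" "\<lambda>s. s <# L"] by simp
  also have "\<dots> = (\<Sum>C\<in>(\<lambda>s. s <# L) ` S. card L)"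
  proof (rule sum.cong [OF refl], clarify)
    fix s assume s: "s \<in> S"
    have "s <# L \<in> lcosets L" using s S by (auto simp: LCOSETS_def)
    then show "card {t \<in> S. t <# L = s <# L} = card L"
      using l_card_cosets_equal [OF _ subgroup.subset [OF L] fin_G] by (simp add: fibre [OF s])
  qed
  finally show ?thesis by (simp add: mult.commute)
qed

lemma double_coset_fibre:
  assumes L: "subgroup L G" and M: "subgroup M G" and D: "D \<in> double_cosets G L M"
  shows "{d \<in> carrier G. L <#> (d <# M) = D} = D"
proof -
  obtain d where d: "d \<in> carrier G" "D = L <#> (d <# M)" using D by (auto simp: double_cosets_def)
  have "D \<subseteq> carrier G"
    using d subgroup.mem_carrier [OF L] subgroup.mem_carrier [OF M] by (auto simp: mem_double_coset)
  then show ?thesis using double_coset_eq [OF L M d(1)] double_coset_ne [OF L M] d(2) by auto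
qed

lemma finite_double_cosets: "finite (carrier G) \<Longrightarrow> finite (double_cosets G K L)"
proof -
  assume fin_G: "finite (carrier G)"
  have "double_cosets G K L = (\<lambda>s. K <#> (s <# L)) ` carrier G" by (auto simp: double_cosets_def)
  then show ?thesis using fin_G by simp
qed

lemma some_in_double_coset:
  assumes "subgroup K G" "subgroup L G" "D \<in> double_cosets G K L"
  shows "(SOME s. s \<in> D) \<in> D" "(SOME s. s \<in> D) \<in> carrier G"
proof -
  have "\<exists>s. s \<in> D" using assms double_coset_ne [OF assms(1,2)] by (auto simp: double_cosets_def)
  then show "(SOME s. s \<in> D) \<in> D" by (rule someI_ex)
  then show "(SOME s. s \<in> D) \<in> carrier G" using double_coset_fibre [OF assms] by blast
qed

text \<open>
  The product map \<open>(l, m) \<mapsto> l \<otimes> s \<otimes> m\<close> from \<open>L \<times> M\<close> onto the double coset has all its fibres in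
  bijection with \<open>L \<inter> conj_set G s M\<close>.
\<close>

lemma card_double_coset:
  assumes fin_G: "finite (carrier G)" and L: "subgroup L G" and M: "subgroup M G"
    and s: "s \<in> carrier G"
  shows "card (L <#> (s <# M)) * card (L \<inter> conj_set G s M) = card L * card M"
proof -
  let ?f = "\<lambda>(l, m). l \<otimes> (s \<otimes> m)"
  have Lc: "\<And>l. l \<in> L \<Longrightarrow> l \<in> carrier G" and Mc: "\<And>m. m \<in> M \<Longrightarrow> m \<in> carrier G"
    using subgroup.mem_carrier [OF L] subgroup.mem_carrier [OF M] by auto
  have fin: "finite (L \<times> M)"
    using Lc Mc fin_G by (meson finite_SigmaI finite_subset subsetI)
  have img: "L <#> (s <# M) = ?f ` (L \<times> M)"
    by (auto simp: set_mult_def l_coset_def image_iff)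
  have fibre: "card {z \<in> L \<times> M. ?f z = x} = card (L \<inter> conj_set G s M)"
    if x: "x \<in> ?f ` (L \<times> M)" for x
  proof -
    obtain l0 m0 where 0: "l0 \<in> L" "m0 \<in> M" "x = l0 \<otimes> (s \<otimes> m0)" using x by auto
    have c0: "l0 \<in> carrier G" "m0 \<in> carrier G" using 0 Lc Mc by auto
    let ?g = "\<lambda>y. (l0 \<otimes> y, inv s \<otimes> (inv y \<otimes> (s \<otimes> m0)))"
    have mem: "y \<in> L \<inter> conj_set G s M \<longleftrightarrow> y \<in> L \<and> inv s \<otimes> y \<otimes> s \<in> M" for y
      using Lc conj_set_iff [OF subgroup.subset [OF M] s] by auto
    have "bij_betw ?g (L \<inter> conj_set G s M) {z \<in> L \<times> M. ?f z = x}"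
    proof (rule bij_betw_byWitness [where f' = "\<lambda>(l, m). inv l0 \<otimes> l"])
      show "\<forall>y\<in>L \<inter> conj_set G s M. (\<lambda>(l, m). inv l0 \<otimes> l) (?g y) = y"
        using c0 Lc by (auto simp: inv_cancel)
      show "\<forall>z\<in>{z \<in> L \<times> M. ?f z = x}. ?g ((\<lambda>(l, m). inv l0 \<otimes> l) z) = z"
      proof (clarsimp simp: 0(3))
        fix l m assume lm: "l \<in> L" "m \<in> M" "l \<otimes> (s \<otimes> m) = l0 \<otimes> (s \<otimes> m0)"
        have c: "l \<in> carrier G" "m \<in> carrier G" using lm Lc Mc by auto
        have "inv s \<otimes> (inv (inv l0 \<otimes> l) \<otimes> (s \<otimes> m0)) = inv s \<otimes> (inv l \<otimes> (l0 \<otimes> (s \<otimes> m0)))"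
          using c c0 s by (simp add: inv_mult_group m_assoc)
        also have "\<dots> = m" using c s by (simp add: lm(3) [symmetric] inv_cancel)
        finally show "l0 \<otimes> (inv l0 \<otimes> l) = l \<and> inv s \<otimes> (inv (inv l0 \<otimes> l) \<otimes> (s \<otimes> m0)) = m"
          using c c0 by (simp add: inv_cancel)
      qed
      show "?g ` (L \<inter> conj_set G s M) \<subseteq> {z \<in> L \<times> M. ?f z = x}"
      proof (rule image_subsetI)
        fix y assume y: "y \<in> L \<inter> conj_set G s M"
        then have yL: "y \<in> L" and yM: "inv s \<otimes> y \<otimes> s \<in> M" using mem by auto
        have c: "y \<in> carrier G" using yL Lc by auto
        have "inv (inv s \<otimes> y \<otimes> s) \<otimes> m0 \<in> M"
          using yM 0 M by (auto intro: subgroup.m_closed subgroup.m_inv_closed)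
        also have "inv (inv s \<otimes> y \<otimes> s) \<otimes> m0 = inv s \<otimes> (inv y \<otimes> (s \<otimes> m0))"
          using c s c0 by (simp add: inv_mult_group m_assoc)
        finally show "?g y \<in> {z \<in> L \<times> M. ?f z = x}"
          using c c0 s yL 0 L by (auto simp: inv_cancel m_assoc intro: subgroup.m_closed)
      qed
      show "(\<lambda>(l, m). inv l0 \<otimes> l) ` {z \<in> L \<times> M. ?f z = x} \<subseteq> L \<inter> conj_set G s M"
      proof (rule image_subsetI)
        fix z assume "z \<in> {z \<in> L \<times> M. ?f z = x}"
        then obtain l m where z: "z = (l, m)" and lm: "l \<in> L" "m \<in> M" "l \<otimes> (s \<otimes> m) = l0 \<otimes> (s \<otimes> m0)"
          using 0(3) by auto
        have c: "l \<in> carrier G" "m \<in> carrier G" using lm Lc Mc by auto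
        have "l = l0 \<otimes> (s \<otimes> m0) \<otimes> inv (s \<otimes> m)"
          using c c0 s by (simp add: lm(3) [symmetric] m_assoc)
        then have "inv s \<otimes> (inv l0 \<otimes> l) \<otimes> s = m0 \<otimes> inv m"
          using c c0 s by (simp add: m_assoc inv_mult_group inv_cancel)
        then show "(\<lambda>(l, m). inv l0 \<otimes> l) z \<in> L \<inter> conj_set G s M"
          unfolding z mem using lm 0 L M by (auto intro: subgroup.m_closed subgroup.m_inv_closed)
      qed
    qed
    then show ?thesis by (simp add: bij_betw_same_card)
  qed
  have "card L * card M = (\<Sum>z\<in>L \<times> M. 1)" by (simp add: card_cartesian_product)
  also have "\<dots> = (\<Sum>x\<in>?f ` (L \<times> M). card {z \<in> L \<times> M. ?f z = x})"
    using sum.image_gen [OF fin, of "\<lambda>_. 1::nat" ?f] by simp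
  also have "\<dots> = card (?f ` (L \<times> M)) * card (L \<inter> conj_set G s M)"
    using sum.cong [OF refl fibre] by simp
  finally show ?thesis by (simp add: img)
qed

end

section \<open>The numbers gamma and conjugacy of monomial pairs\<close>

text \<open>A finite group \<open>G\<close> together with an abelian group \<open>A\<close> of coefficients.\<close>

locale fibered = group G + A: comm_group A
  for G (structure) and A (structure) +
  assumes finite_carrier: "finite (carrier G)"
begin

lemma pairs_subgroup: "p \<in> mon_pairs G A \<Longrightarrow> subgroup (fst p) G"
  by (auto simp: mon_pairs_def)

lemma pairs_subset: "p \<in> mon_pairs G A \<Longrightarrow> fst p \<subseteq> carrier G"
  by (rule subgroup.subset [OF pairs_subgroup])

lemma pairs_card_pos: "p \<in> mon_pairs G A \<Longrightarrow> card (fst p) > 0"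
  using pairs_subgroup pairs_subset finite_carrier
  by (metis card_gt_0_iff finite_subset subgroup.one_closed empty_iff)

lemma finite_fst: "p \<in> mon_pairs G A \<Longrightarrow> finite (fst p)"
  using pairs_subset finite_carrier by (rule finite_subset)

lemma mon_conj_coset:
  assumes q: "q \<in> mon_pairs G A" and s: "s \<in> carrier G" and t: "t \<in> s <# fst q"
  shows "mon_conj G t q = mon_conj G s q"
proof -
  obtain l where l: "l \<in> fst q" "t = s \<otimes> l" using t by (auto simp: l_coset_def)
  have "l \<in> carrier G" using l pairs_subset [OF q] by auto
  then show ?thesis
    using mon_conj_mult [OF pairs_subset [OF q] s, of l] mon_conj_fixed [OF A.comm_group_axioms q l(1)] l(2)
    by simp
qed

lemma card_mult_mon_gamma:
  assumes q: "q \<in> mon_pairs G A"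
  shows "card (fst q) * mon_gamma G p q = card {s \<in> carrier G. mon_le p (mon_conj G s q)}"
proof -
  let ?S = "{s \<in> carrier G. mon_le p (mon_conj G s q)}"
  have "card ?S = card (fst q) * card ((\<lambda>s. s <# fst q) ` ?S)"
  proof (rule card_union_of_cosets [OF finite_carrier pairs_subgroup [OF q]])
    fix s t assume s: "s \<in> ?S" and t: "t \<in> s <# fst q"
    then have "t \<in> carrier G" using l_coset_carrier [OF _ _ pairs_subgroup [OF q]] by blast
    then show "t \<in> ?S" using s t mon_conj_coset [OF q _ t] by simp
  qed auto
  moreover have "mon_gamma G p q = card ((\<lambda>s. s <# fst q) ` ?S)"
    unfolding mon_gamma_def by (rule arg_cong [of _ _ card]) auto
  ultimately show ?thesis by simp
qed

lemma mon_gamma_nonzero_iff: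
  assumes "q \<in> mon_pairs G A"
  shows "mon_gamma G p q \<noteq> 0 \<longleftrightarrow> (\<exists>s\<in>carrier G. mon_le p (mon_conj G s q))"
proof -
  have "mon_gamma G p q \<noteq> 0 \<longleftrightarrow> card {s \<in> carrier G. mon_le p (mon_conj G s q)} \<noteq> 0"
    using card_mult_mon_gamma [OF assms, of p] pairs_card_pos [OF assms] by (metis mult_eq_0_iff not_less_zero)
  then show ?thesis using finite_carrier by auto
qed

lemma mon_le_card_eq:
  assumes "mon_le p q" "p \<in> mon_pairs G A" "q \<in> mon_pairs G A" "card (fst q) \<le> card (fst p)"
  shows "p = q"
proof -
  obtain K \<phi> L \<psi> where pq: "p = (K, \<phi>)" "q = (L, \<psi>)" by (metis surj_pair)
  have "K = L" using assms finite_fst [OF assms(3)] card_seteq [of L K]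
    by (simp add: pq mon_le_def)
  moreover have "\<psi> \<in> extensional L" using assms by (auto simp: pq mon_pairs_def Hom_set_def)
  ultimately show ?thesis using assms(1) by (auto simp: pq mon_le_def extensional_restrict)
qed

lemma mon_orbit_eq_if_gamma:
  assumes p: "p \<in> mon_pairs G A" and q: "q \<in> mon_pairs G A"
    and "mon_gamma G p q \<noteq> 0" "card (fst q) \<le> card (fst p)"
  shows "mon_orbit G p = mon_orbit G q"
proof -
  obtain s where s: "s \<in> carrier G" "mon_le p (mon_conj G s q)"
    using assms mon_gamma_nonzero_iff by blast
  have "card (fst (mon_conj G s q)) = card (fst q)"
    using card_conj_set [OF pairs_subset [OF q] s(1)] by (simp add: fst_mon_conj)
  then have "p = mon_conj G s q"
    using mon_le_card_eq [OF s(2) p mon_conj_pairs [OF q s(1)]] assms by simp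
  then show ?thesis using mon_orbit_conj [OF pairs_subset [OF q] s(1)] by simp
qed

lemma mon_le_refl: "p \<in> mon_pairs G A \<Longrightarrow> mon_le p p"
  by (auto simp: mon_pairs_def mon_le_def Hom_set_def extensional_restrict)

lemma mon_orbit_eqD:
  assumes "p \<in> mon_pairs G A" "mon_orbit G p = mon_orbit G q"
  obtains s where "s \<in> carrier G" "p = mon_conj G s q"
proof -
  have "p \<in> mon_orbit G q" using mon_orbit_refl [OF A.comm_group_axioms assms(1)] assms(2) by simp
  then show ?thesis using that by (auto simp: mon_orbit_def)
qed

lemma mon_gamma_nonzero_if_orbit_eq:
  assumes "p \<in> mon_pairs G A" "q \<in> mon_pairs G A" "mon_orbit G p = mon_orbit G q"
  shows "mon_gamma G p q \<noteq> 0"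
  using mon_orbit_eqD [OF assms(1,3)] mon_gamma_nonzero_iff [OF assms(2)] mon_le_refl [OF assms(1)] by metis

lemma card_le_if_gamma:
  assumes q: "q \<in> mon_pairs G A" and "mon_gamma G p q \<noteq> 0"
  shows "card (fst p) \<le> card (fst q)"
proof -
  obtain s where s: "s \<in> carrier G" "mon_le p (mon_conj G s q)"
    using assms mon_gamma_nonzero_iff by blast
  have "fst p \<subseteq> fst (mon_conj G s q)" using s(2) by (auto simp: mon_le_def split: prod.splits)
  then have "card (fst p) \<le> card (fst (mon_conj G s q))"
    using finite_fst [OF mon_conj_pairs [OF q s(1)]] by (intro card_mono)
  then show ?thesis using card_conj_set [OF pairs_subset [OF q] s(1)] by (simp add: fst_mon_conj)
qed

text \<open>
  Monomial pairs are conjugate exactly when each lies below a conjugate of the other.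
\<close>

lemma mon_orbit_eq_iff_gamma:
  assumes "p \<in> mon_pairs G A" "q \<in> mon_pairs G A"
  shows "mon_orbit G p = mon_orbit G q \<longleftrightarrow> mon_gamma G p q \<noteq> 0 \<and> mon_gamma G q p \<noteq> 0"
  using assms mon_orbit_eq_if_gamma card_le_if_gamma mon_gamma_nonzero_if_orbit_eq by metis

lemma mon_gamma_conj_right:
  assumes q: "q \<in> mon_pairs G A" and g: "g \<in> carrier G"
  shows "mon_gamma G p (mon_conj G g q) = mon_gamma G p q"
proof -
  have eq: "mon_conj G s (mon_conj G g q) = mon_conj G (s \<otimes> g) q" if "s \<in> carrier G" for s
    using mon_conj_mult [OF pairs_subset [OF q] that g] .
  have "bij_betw (\<lambda>s. s \<otimes> g) {s \<in> carrier G. mon_le p (mon_conj G s (mon_conj G g q))}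
      {s \<in> carrier G. mon_le p (mon_conj G s q)}"
    by (rule bij_betw_byWitness [where f' = "\<lambda>s. s \<otimes> inv g"])
       (use g in \<open>auto simp: eq m_assoc\<close>)
  then have "card (fst q) * mon_gamma G p (mon_conj G g q) = card (fst q) * mon_gamma G p q"
    using card_mult_mon_gamma [OF q, of p] card_mult_mon_gamma [OF mon_conj_pairs [OF q g], of p]
      card_conj_set [OF pairs_subset [OF q] g] by (simp add: fst_mon_conj bij_betw_same_card)
  then show ?thesis using pairs_card_pos [OF q] by simp
qed

section \<open>The ghost of a monomial pair\<close>

lemma mon_inter_pairs:
  assumes p: "p \<in> mon_pairs G A" and q: "q \<in> mon_pairs G A"
  shows "mon_inter A p q \<in> mon_pairs G A"
proof -
  obtain K \<phi> L \<psi> where pq: "p = (K, \<phi>)" "q = (L, \<psi>)" by (metis surj_pair)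
  have KL: "subgroup K G" "subgroup L G" using p q by (auto simp: pq mon_pairs_def)
  have "(\<lambda>x\<in>K \<inter> L. \<phi> x \<otimes>\<^bsub>A\<^esub> \<psi> x) \<in> hom (G\<lparr>carrier := K \<inter> L\<rparr>) A"
    using p q subgroup.m_closed [OF KL(1)] subgroup.m_closed [OF KL(2)]
    by (auto simp: pq mon_pairs_def Hom_set_def hom_def Pi_iff A.m_ac)
  then show ?thesis
    using subgroups_Inter_pair [OF KL] by (simp add: pq mon_pairs_def Hom_set_def mon_inter_def)
qed

text \<open>
  The ghost of a pair \<open>q = (L, \<psi>)\<close> at \<open>K\<close>: the element of the group ring of \<open>Hom(K, A)\<close> whose
  coefficient at \<open>\<phi>\<close> is \<open>\<gamma>\<close> of \<open>(K, \<phi>)\<close> and \<open>q\<close>. No condition is put on \<open>\<phi>\<close>: the coefficient is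
  zero when \<open>K\<close> is a subgroup and \<open>\<phi>\<close> is not a homomorphism on it (lemma \<open>keys_ghost\<close> below).
\<close>

definition ghost :: "'a set \<Rightarrow> 'a set \<times> ('a \<Rightarrow> 'c) \<Rightarrow> (('a \<Rightarrow> 'c) \<Rightarrow>\<^sub>0 int)"
  where "ghost K q = Abs_poly_mapping (\<lambda>\<phi>. int (mon_gamma G (K, \<phi>) q))"

text \<open>
  The elements \<open>s\<close> for which \<open>K\<close> is contained in the conjugate \<open>\<^sup>sL\<close> of \<open>L = fst q\<close>.
\<close>

definition embeddings :: "'a set \<Rightarrow> 'a set \<times> ('a \<Rightarrow> 'c) \<Rightarrow> 'a set"
  where "embeddings K q = {s \<in> carrier G. K \<subseteq> conj_set G s (fst q)}"

text \<open>
  For \<open>s\<close> among the embeddings of \<open>K\<close>, the restriction to \<open>K\<close> of the conjugate by \<open>s\<close> of the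
  homomorphism \<open>snd q\<close>.
\<close>

definition conj_res :: "'a set \<Rightarrow> 'a set \<times> ('a \<Rightarrow> 'c) \<Rightarrow> 'a \<Rightarrow> ('a \<Rightarrow> 'c)"
  where "conj_res K q s = restrict (snd (mon_conj G s q)) K"

lemma mon_le_conj_iff:
  "s \<in> carrier G \<and> mon_le (K, \<phi>) (mon_conj G s q) \<longleftrightarrow> s \<in> embeddings K q \<and> conj_res K q s = \<phi>"
  by (auto simp: mon_le_def embeddings_def conj_res_def mon_conj_def split: prod.splits)

lemma finite_embeddings: "finite (embeddings K q)"
  using finite_carrier by (simp add: embeddings_def)

lemma lookup_ghost:
  assumes q: "q \<in> mon_pairs G A"
  shows "Poly_Mapping.lookup (ghost K q) \<phi> = int (mon_gamma G (K, \<phi>) q)"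
proof -
  have "{\<phi>. int (mon_gamma G (K, \<phi>) q) \<noteq> 0} \<subseteq> conj_res K q ` embeddings K q"
    using mon_gamma_nonzero_iff [OF q] mon_le_conj_iff [of _ K _ q] by (simp add: subset_iff image_iff) metis
  then have "finite {\<phi>. int (mon_gamma G (K, \<phi>) q) \<noteq> 0}"
    using finite_embeddings finite_subset by blast
  then show ?thesis by (simp add: ghost_def Abs_poly_mapping_inverse)
qed

text \<open>
  Summing over elements \<open>s\<close> instead of cosets \<open>s L\<close> counts every term \<open>card L\<close> times.
\<close>

lemma ghost_unnormalised:
  assumes q: "q \<in> mon_pairs G A"
  shows "frag_cmul (int (card (fst q))) (ghost K q) = (\<Sum>s\<in>embeddings K q. frag_of (conj_res K q s))"
proof (rule poly_mapping_eqI)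
  fix \<phi>
  have "int (card (fst q)) * int (mon_gamma G (K, \<phi>) q)
      = int (card {s \<in> carrier G. mon_le (K, \<phi>) (mon_conj G s q)})"
    using card_mult_mon_gamma [OF q] by (metis of_nat_mult)
  also have "{s \<in> carrier G. mon_le (K, \<phi>) (mon_conj G s q)} = {s \<in> embeddings K q. \<phi> = conj_res K q s}"
    using mon_le_conj_iff by auto
  also have "int (card \<dots>) = (\<Sum>s\<in>embeddings K q. if \<phi> = conj_res K q s then 1 else 0)"
    using finite_embeddings by (simp add: sum.If_cases Int_def)
  finally show "Poly_Mapping.lookup (frag_cmul (int (card (fst q))) (ghost K q)) \<phi> =
      Poly_Mapping.lookup (\<Sum>s\<in>embeddings K q. frag_of (conj_res K q s)) \<phi>"
    by (simp add: lookup_ghost [OF q] lookup_sum)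
qed

lemma ghost_orbit_cong:
  assumes p: "p \<in> mon_pairs G A" and q: "q \<in> mon_pairs G A" and e: "mon_orbit G p = mon_orbit G q"
  shows "ghost K p = ghost K q" and "card (fst p) = card (fst q)"
proof -
  obtain s where s: "s \<in> carrier G" "p = mon_conj G s q" using mon_orbit_eqD [OF p e] .
  show "ghost K p = ghost K q" by (simp add: ghost_def s(2) mon_gamma_conj_right [OF q s(1)])
  show "card (fst p) = card (fst q)"
    using card_conj_set [OF pairs_subset [OF q] s(1)] by (simp add: s(2) fst_mon_conj)
qed

text \<open>
  The term at \<open>s\<close> of the intersection of \<open>q\<close> and \<open>\<^sup>dr\<close> is the product of the term of \<open>q\<close> at \<open>s\<close> and
  the term of \<open>r\<close> at \<open>s \<otimes> d\<close>.
\<close>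

lemma embeddings_inter:
  assumes q: "q \<in> mon_pairs G A" and r: "r \<in> mon_pairs G A" and s: "s \<in> carrier G" and d: "d \<in> carrier G"
  shows "s \<in> embeddings K (mon_inter A q (mon_conj G d r)) \<longleftrightarrow>
           s \<in> embeddings K q \<and> s \<otimes> d \<in> embeddings K r"
    and "s \<in> embeddings K (mon_inter A q (mon_conj G d r)) \<Longrightarrow>
           conj_res K (mon_inter A q (mon_conj G d r)) s =
           conj_res K q s \<otimes>\<^bsub>Hom_group G A K\<^esub> conj_res K r (s \<otimes> d)"
proof -
  have eq: "mon_conj G s (mon_inter A q (mon_conj G d r)) = mon_inter A (mon_conj G s q) (mon_conj G (s \<otimes> d) r)"
    using mon_conj_inter [OF pairs_subset [OF q] pairs_subset [OF mon_conj_pairs [OF r d]] s]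
    by (simp add: mon_conj_mult [OF pairs_subset [OF r] s d])
  have fst: "conj_set G s (fst (mon_inter A q (mon_conj G d r))) = conj_set G s (fst q) \<inter> conj_set G (s \<otimes> d) (fst r)"
    by (simp only: fst_mon_conj [symmetric] eq) (simp add: mon_inter_def split: prod.splits)
  show 1: "s \<in> embeddings K (mon_inter A q (mon_conj G d r)) \<longleftrightarrow>
           s \<in> embeddings K q \<and> s \<otimes> d \<in> embeddings K r"
    using s d by (simp add: embeddings_def fst)
  assume "s \<in> embeddings K (mon_inter A q (mon_conj G d r))"
  then have "K \<subseteq> fst (mon_conj G s q) \<inter> fst (mon_conj G (s \<otimes> d) r)"
    by (simp add: embeddings_def fst fst_mon_conj)
  then show "conj_res K (mon_inter A q (mon_conj G d r)) s =
           conj_res K q s \<otimes>\<^bsub>Hom_group G A K\<^esub> conj_res K r (s \<otimes> d)"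
    unfolding conj_res_def eq
    by (auto simp: mon_inter_def Hom_group_def fun_eq_iff restrict_def split: prod.splits)
qed

text \<open>
  The ghost is multiplicative on the basis. Both sides are compared after multiplication by
  \<open>card L * card M\<close>, which turns them into sums over pairs of group elements.
\<close>

lemma ghost_mon_prod:
  assumes q: "q \<in> mon_pairs G A" and r: "r \<in> mon_pairs G A"
    and rep: "\<And>D. D \<in> double_cosets G (fst q) (fst r) \<Longrightarrow> rep D \<in> D"
  shows "(\<Sum>D\<in>double_cosets G (fst q) (fst r). ghost K (mon_inter A q (mon_conj G (rep D) r))) =
    conv (Hom_group G A K) (ghost K q) (ghost K r)"
proof -
  let ?L = "fst q" and ?M = "fst r"
  let ?DC = "double_cosets G ?L ?M"
  let ?n = "int (card ?L) * int (card ?M)"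
  define I where "I d = mon_inter A q (mon_conj G d r)" for d
  define F where "F d = (\<Sum>s\<in>embeddings K (I d). frag_of (conj_res K (I d) s))" for d
  define T where "T s t = frag_of (conj_res K q s \<otimes>\<^bsub>Hom_group G A K\<^esub> conj_res K r t)" for s t
  have sub: "subgroup ?L G" "subgroup ?M G" using q r by (auto intro: pairs_subgroup)
  have DC: "?DC = (\<lambda>d. ?L <#> (d <# ?M)) ` carrier G" by (auto simp: double_cosets_def)
  have Ip: "I d \<in> mon_pairs G A" if "d \<in> carrier G" for d
    unfolding I_def using that q r by (intro mon_inter_pairs mon_conj_pairs)
  have Dc: "d \<in> carrier G" if "D \<in> ?DC" "d \<in> D" for d D
    using double_coset_fibre [OF sub that(1)] that(2) by auto
  have summand: "frag_cmul ?n (ghost K (I (rep D))) = (\<Sum>d\<in>D. F d)" if D: "D \<in> ?DC" for D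
  proof -
    have rc: "rep D \<in> carrier G" using Dc [OF D rep [OF D]] .
    have Deq: "D = ?L <#> (rep D <# ?M)" using double_coset_fibre [OF sub D] rep [OF D] by auto
    \<comment> \<open>the unnormalised ghost is constant along the double coset\<close>
    have const: "F d = frag_cmul (int (card (fst (I (rep D))))) (ghost K (I (rep D)))" if d: "d \<in> D" for d
    proof -
      have "mon_orbit G (I d) = mon_orbit G (I (rep D))"
        unfolding I_def by (rule mon_prod_independent [OF A.comm_group_axioms q r D d rep [OF D]])
      then show ?thesis
        using ghost_orbit_cong [OF Ip [OF Dc [OF D d]] Ip [OF rc]] ghost_unnormalised [OF Ip [OF Dc [OF D d]]]
        by (simp add: F_def)
    qed
    have "fst (I (rep D)) = ?L \<inter> conj_set G (rep D) ?M"
      by (simp add: I_def mon_inter_def fst_mon_conj [symmetric] split: prod.splits)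
    then have "card D * card (fst (I (rep D))) = card ?L * card ?M"
      using card_double_coset [OF finite_carrier sub rc] Deq by simp
    then have n: "?n = int (card D) * int (card (fst (I (rep D))))" by (metis of_nat_mult)
    show ?thesis by (simp add: const sum_const_frag n)
  qed
  have "frag_cmul ?n (\<Sum>D\<in>?DC. ghost K (I (rep D))) = (\<Sum>D\<in>?DC. \<Sum>d\<in>D. F d)"
    by (simp add: frag_cmul_sum summand)
  also have "\<dots> = (\<Sum>D\<in>?DC. \<Sum>d\<in>{d \<in> carrier G. ?L <#> (d <# ?M) = D}. F d)"
    by (simp add: double_coset_fibre [OF sub])
  also have "\<dots> = (\<Sum>d\<in>carrier G. F d)"
    by (rule sum.group) (use finite_carrier in \<open>auto simp: DC\<close>)
  also have "\<dots> = (\<Sum>d\<in>carrier G. \<Sum>s\<in>carrier G.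
      if s \<in> embeddings K q \<and> s \<otimes> d \<in> embeddings K r then T s (s \<otimes> d) else 0)"
  proof (rule sum.cong [OF refl])
    fix d assume d: "d \<in> carrier G"
    have "F d = (\<Sum>s\<in>carrier G. if s \<in> embeddings K (I d) then frag_of (conj_res K (I d) s) else 0)"
      unfolding F_def
      by (subst sum.inter_restrict [OF finite_carrier, symmetric]) (auto simp: embeddings_def intro: sum.cong)
    also have "\<dots> = (\<Sum>s\<in>carrier G. if s \<in> embeddings K q \<and> s \<otimes> d \<in> embeddings K r then T s (s \<otimes> d) else 0)"
    proof (rule sum.cong [OF refl])
      fix s assume s: "s \<in> carrier G"
      show "(if s \<in> embeddings K (I d) then frag_of (conj_res K (I d) s) else 0) =
          (if s \<in> embeddings K q \<and> s \<otimes> d \<in> embeddings K r then T s (s \<otimes> d) else 0)"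
        using embeddings_inter [OF q r s d, of K] unfolding I_def T_def by presburger
    qed
    finally show "F d = (\<Sum>s\<in>carrier G. if s \<in> embeddings K q \<and> s \<otimes> d \<in> embeddings K r then T s (s \<otimes> d) else 0)" .
  qed
  also have "\<dots> = (\<Sum>s\<in>carrier G. \<Sum>d\<in>carrier G.
      if s \<in> embeddings K q \<and> s \<otimes> d \<in> embeddings K r then T s (s \<otimes> d) else 0)"
    by (rule sum.swap)
  also have "\<dots> = (\<Sum>s\<in>carrier G. \<Sum>t\<in>carrier G. if s \<in> embeddings K q \<and> t \<in> embeddings K r then T s t else 0)"
  proof (rule sum.cong [OF refl])
    fix s assume s: "s \<in> carrier G"
    \<comment> \<open>substitute \<open>t = s \<otimes> d\<close> for fixed \<open>s\<close>\<close>
    have "bij_betw (\<lambda>d. s \<otimes> d) (carrier G) (carrier G)"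
      by (rule bij_betw_byWitness [where f' = "\<lambda>d. inv s \<otimes> d"]) (use s in \<open>auto simp: inv_cancel\<close>)
    then show "(\<Sum>d\<in>carrier G. if s \<in> embeddings K q \<and> s \<otimes> d \<in> embeddings K r then T s (s \<otimes> d) else 0) =
        (\<Sum>t\<in>carrier G. if s \<in> embeddings K q \<and> t \<in> embeddings K r then T s t else 0)"
      by (rule sum.reindex_bij_betw)
  qed
  also have "\<dots> = (\<Sum>s\<in>embeddings K q. \<Sum>t\<in>embeddings K r. T s t)"
  proof -
    have e: "embeddings K p = carrier G \<inter> embeddings K p" for p by (auto simp: embeddings_def)
    have "(\<Sum>s\<in>embeddings K q. \<Sum>t\<in>embeddings K r. T s t) =
        (\<Sum>s\<in>carrier G. if s \<in> embeddings K q
           then \<Sum>t\<in>carrier G. if t \<in> embeddings K r then T s t else 0 else 0)"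
      by (subst e, subst e) (simp add: sum.inter_restrict [OF finite_carrier])
    also have "\<dots> = (\<Sum>s\<in>carrier G. \<Sum>t\<in>carrier G. if s \<in> embeddings K q \<and> t \<in> embeddings K r then T s t else 0)"
      by (intro sum.cong) auto
    finally show ?thesis by simp
  qed
  also have "\<dots> = conv (Hom_group G A K) (\<Sum>s\<in>embeddings K q. frag_of (conj_res K q s))
      (\<Sum>t\<in>embeddings K r. frag_of (conj_res K r t))"
    using finite_embeddings by (simp add: conv_sum_frag_of T_def)
  also have "\<dots> = frag_cmul ?n (conv (Hom_group G A K) (ghost K q) (ghost K r))"
    by (simp add: ghost_unnormalised [OF q, symmetric] ghost_unnormalised [OF r, symmetric] conv_cmul)
  finally have "frag_cmul ?n (\<Sum>D\<in>?DC. ghost K (I (rep D))) =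
      frag_cmul ?n (conv (Hom_group G A K) (ghost K q) (ghost K r))" .
  moreover have "?n \<noteq> 0" using pairs_card_pos [OF q] pairs_card_pos [OF r] by simp
  ultimately show ?thesis unfolding I_def by (metis frag_cmul_cancel)
qed

lemma conj_res_Hom:
  assumes K: "subgroup K G" and q: "q \<in> mon_pairs G A" and s: "s \<in> embeddings K q"
  shows "conj_res K q s \<in> Hom_set G A K"
proof -
  have sc: "s \<in> carrier G" and sub: "K \<subseteq> conj_set G s (fst q)" using s by (auto simp: embeddings_def)
  have "snd (mon_conj G s q) \<in> hom (G\<lparr>carrier := conj_set G s (fst q)\<rparr>) A"
    using mon_conj_pairs [OF q sc] by (auto simp: mon_pairs_def Hom_set_def fst_mon_conj [symmetric])
  then show ?thesis
    using sub subgroup.m_closed [OF K] by (auto simp: Hom_set_def conj_res_def hom_def Pi_iff subset_iff)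
qed

lemma keys_ghost:
  assumes K: "subgroup K G" and q: "q \<in> mon_pairs G A"
  shows "Poly_Mapping.keys (ghost K q) \<subseteq> Hom_set G A K"
proof
  fix \<phi> assume "\<phi> \<in> Poly_Mapping.keys (ghost K q)"
  then have "mon_gamma G (K, \<phi>) q \<noteq> 0" by (simp add: in_keys_iff lookup_ghost [OF q])
  then obtain s where "s \<in> embeddings K q" "conj_res K q s = \<phi>"
    using mon_gamma_nonzero_iff [OF q] mon_le_conj_iff by blast
  then show "\<phi> \<in> Hom_set G A K" using conj_res_Hom [OF K q] by blast
qed

lemma trivial_pair: "(carrier G, \<lambda>x\<in>carrier G. \<one>\<^bsub>A\<^esub>) \<in> mon_pairs G A"
  by (auto simp: mon_pairs_def Hom_set_def hom_def subgroup_self)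

text \<open>
  The ghost of the identity element of the ring is the trivial homomorphism.
\<close>

lemma ghost_trivial:
  assumes "K \<subseteq> carrier G"
  shows "ghost K (carrier G, \<lambda>x\<in>carrier G. \<one>\<^bsub>A\<^esub>) = frag_of (\<lambda>x\<in>K. \<one>\<^bsub>A\<^esub>)" (is "ghost K ?q = _")
proof -
  have c: "conj_set G s (carrier G) = carrier G" if "s \<in> carrier G" for s
    using that by (auto simp: conj_set_iff)
  have e: "embeddings K ?q = carrier G" using assms by (auto simp: embeddings_def c)
  have r: "conj_res K ?q s = (\<lambda>x\<in>K. \<one>\<^bsub>A\<^esub>)" if "s \<in> carrier G" for s
    using that assms by (auto simp: conj_res_def mon_conj_def c restrict_def fun_eq_iff)
  have "frag_cmul (int (card (carrier G))) (ghost K ?q) =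
      frag_cmul (int (card (carrier G))) (frag_of (\<lambda>x\<in>K. \<one>\<^bsub>A\<^esub>))"
    using ghost_unnormalised [OF trivial_pair, of K] by (simp add: e r sum_const_frag)
  moreover have "int (card (carrier G)) \<noteq> 0" using pairs_card_pos [OF trivial_pair] by simp
  ultimately show ?thesis by (metis frag_cmul_cancel)
qed

section \<open>The ghost homomorphisms on the ring\<close>

text \<open>
  The linear extension of the ghost to the fibered Burnside ring; by \<open>ghost_map_orbit\<close> below, the choice
  of representatives of the orbits does not matter.
\<close>

definition ghost_map :: "'a set \<Rightarrow> (('a set \<times> ('a \<Rightarrow> 'c)) set \<Rightarrow>\<^sub>0 int) \<Rightarrow> (('a \<Rightarrow> 'c) \<Rightarrow>\<^sub>0 int)"
  where "ghost_map K = frag_extend (\<lambda>U. ghost K (SOME q. q \<in> U))"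

lemma orbit_rep:
  assumes "U \<in> mon_orbits G A"
  shows "(SOME q. q \<in> U) \<in> mon_pairs G A" and "mon_orbit G (SOME q. q \<in> U) = U"
proof -
  obtain p where p: "p \<in> mon_pairs G A" "U = mon_orbit G p" using assms by (auto simp: mon_orbits_def)
  have "(SOME q. q \<in> U) \<in> U"
    using mon_orbit_refl [OF A.comm_group_axioms p(1)] unfolding p(2) by (rule someI)
  then obtain g where g: "g \<in> carrier G" "(SOME q. q \<in> U) = mon_conj G g p"
    unfolding p(2) by (auto simp: mon_orbit_def)
  then show "(SOME q. q \<in> U) \<in> mon_pairs G A" "mon_orbit G (SOME q. q \<in> U) = U"
    using mon_conj_pairs [OF p(1)] mon_orbit_conj [OF pairs_subset [OF p(1)]] p(2) by simp_all
qed

lemma ghost_map_orbit: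
  assumes "q \<in> mon_pairs G A"
  shows "ghost_map K (frag_of (mon_orbit G q)) = ghost K q"
proof -
  have "mon_orbit G q \<in> mon_orbits G A" using assms by (auto simp: mon_orbits_def)
  then show ?thesis
    using ghost_orbit_cong(1) [OF orbit_rep(1) assms orbit_rep(2)] by (simp add: ghost_map_def)
qed

lemma carrier_burnside_iff:
  "x \<in> carrier (burnside_ring A G) \<longleftrightarrow> Poly_Mapping.keys x \<subseteq> mon_orbits G A"
  by (simp add: burnside_ring_def)

lemma orbit_prod_closed:
  assumes U: "U \<in> mon_orbits G A" and V: "V \<in> mon_orbits G A"
  shows "Poly_Mapping.keys (orbit_prod G A U V) \<subseteq> mon_orbits G A"
proof -
  note p = orbit_rep(1) [OF U] and q = orbit_rep(1) [OF V]
  have "mon_inter A (SOME p. p \<in> U) (mon_conj G (SOME s. s \<in> D) (SOME q. q \<in> V)) \<in> mon_pairs G A"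
    if "D \<in> double_cosets G (fst (SOME p. p \<in> U)) (fst (SOME q. q \<in> V))" for D
    using some_in_double_coset(2) [OF pairs_subgroup [OF p] pairs_subgroup [OF q] that] p q
    by (intro mon_inter_pairs mon_conj_pairs)
  then show ?thesis
    unfolding orbit_prod_def mon_prod_def
    by (intro order_trans [OF keys_sum]) (auto simp: mon_orbits_def)
qed

lemma ghost_map_orbit_prod:
  assumes U: "U \<in> mon_orbits G A" and V: "V \<in> mon_orbits G A"
  shows "ghost_map K (orbit_prod G A U V) =
    conv (Hom_group G A K) (ghost K (SOME p. p \<in> U)) (ghost K (SOME q. q \<in> V))"
proof -
  let ?p = "SOME p. p \<in> U" and ?q = "SOME q. q \<in> V"
  note p = orbit_rep(1) [OF U] and q = orbit_rep(1) [OF V]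
  note some = some_in_double_coset [OF pairs_subgroup [OF p] pairs_subgroup [OF q]]
  have pair: "mon_inter A ?p (mon_conj G (SOME s. s \<in> D) ?q) \<in> mon_pairs G A"
    if "D \<in> double_cosets G (fst ?p) (fst ?q)" for D
    using some(2) [OF that] p q by (intro mon_inter_pairs mon_conj_pairs)
  have "ghost_map K (orbit_prod G A U V) =
      (\<Sum>D\<in>double_cosets G (fst ?p) (fst ?q).
         ghost_map K (frag_of (mon_orbit G (mon_inter A ?p (mon_conj G (SOME s. s \<in> D) ?q)))))"
    by (simp add: ghost_map_def orbit_prod_def mon_prod_def frag_extend_sum [OF finite_double_cosets [OF finite_carrier]])
  also have "\<dots> = (\<Sum>D\<in>double_cosets G (fst ?p) (fst ?q). ghost K (mon_inter A ?p (mon_conj G (SOME s. s \<in> D) ?q)))"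
    by (rule sum.cong [OF refl]) (rule ghost_map_orbit [OF pair])
  also have "\<dots> = conv (Hom_group G A K) (ghost K ?p) (ghost K ?q)"
    by (rule ghost_mon_prod [OF p q some(1)])
  finally show ?thesis .
qed

lemma mult_burnside: "x \<otimes>\<^bsub>burnside_ring A G\<^esub> y = frag_extend (\<lambda>U. frag_extend (orbit_prod G A U) y) x"
  by (simp add: burnside_ring_def)

lemma burnside_mult_closed:
  assumes "x \<in> carrier (burnside_ring A G)" "y \<in> carrier (burnside_ring A G)"
  shows "x \<otimes>\<^bsub>burnside_ring A G\<^esub> y \<in> carrier (burnside_ring A G)"
proof -
  have "Poly_Mapping.keys (frag_extend (orbit_prod G A U) y) \<subseteq> mon_orbits G A"
    if "U \<in> Poly_Mapping.keys x" for U
    using that assms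
    by (intro order_trans [OF keys_frag_extend] UN_least orbit_prod_closed) (auto simp: carrier_burnside_iff)
  then show ?thesis
    unfolding carrier_burnside_iff mult_burnside
    by (intro order_trans [OF keys_frag_extend]) auto
qed

lemma ghost_map_mult:
  assumes x: "x \<in> carrier (burnside_ring A G)" and y: "y \<in> carrier (burnside_ring A G)"
  shows "ghost_map K (x \<otimes>\<^bsub>burnside_ring A G\<^esub> y) =
    conv (Hom_group G A K) (ghost_map K x) (ghost_map K y)"
proof -
  have "ghost_map K (x \<otimes>\<^bsub>burnside_ring A G\<^esub> y) =
      frag_extend (\<lambda>U. frag_extend (\<lambda>V. ghost_map K (orbit_prod G A U V)) y) x"
    by (simp add: mult_burnside ghost_map_def frag_extend_extend)
  also have "\<dots> = frag_extend (\<lambda>U. frag_extend (\<lambda>V.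
      conv (Hom_group G A K) (ghost K (SOME p. p \<in> U)) (ghost K (SOME q. q \<in> V))) y) x"
    using x y by (intro frag_extend_eq ghost_map_orbit_prod) (auto simp: carrier_burnside_iff)
  also have "\<dots> = conv (Hom_group G A K) (ghost_map K x) (ghost_map K y)"
    unfolding ghost_map_def conv_extend_left by (simp only: conv_extend_right)
  finally show ?thesis .
qed

lemma ghost_map_one:
  assumes "K \<subseteq> carrier G"
  shows "ghost_map K \<one>\<^bsub>burnside_ring A G\<^esub> = frag_of (\<lambda>x\<in>K. \<one>\<^bsub>A\<^esub>)"
  using ghost_map_orbit [OF trivial_pair] ghost_trivial [OF assms] by (simp add: burnside_ring_def)

lemma burnside_one_closed: "\<one>\<^bsub>burnside_ring A G\<^esub> \<in> carrier (burnside_ring A G)"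
  using trivial_pair by (auto simp: burnside_ring_def mon_orbits_def)

lemma keys_ghost_map:
  assumes "subgroup K G" "x \<in> carrier (burnside_ring A G)"
  shows "Poly_Mapping.keys (ghost_map K x) \<subseteq> Hom_set G A K"
proof -
  have "Poly_Mapping.keys (ghost K (SOME q. q \<in> U)) \<subseteq> Hom_set G A K"
    if "U \<in> Poly_Mapping.keys x" for U
    using that assms by (intro keys_ghost orbit_rep) (auto simp: carrier_burnside_iff)
  then show ?thesis
    unfolding ghost_map_def by (intro order_trans [OF keys_frag_extend]) auto
qed

lemma orbit_rep_in_class_reps:
  assumes S: "subgroup_class_reps G S" and U: "U \<in> mon_orbits G A"
  obtains K \<phi> where "K \<in> S" "\<phi> \<in> Hom_set G A K" "U = mon_orbit G (K, \<phi>)"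
proof -
  obtain p where p: "p \<in> mon_pairs G A" "U = mon_orbit G p" using U by (auto simp: mon_orbits_def)
  obtain R g where R: "R \<in> S" "g \<in> carrier G" "fst p = conj_set G g R"
    using S pairs_subgroup [OF p(1)] unfolding subgroup_class_reps_def by metis
  have Rc: "R \<subseteq> carrier G" using S R(1) subgroup.subset by (auto simp: subgroup_class_reps_def)
  have conj_back: "conj_set G (inv g) (fst p) = R"
  proof -
    have "x \<in> conj_set G (inv g) (conj_set G g R) \<longleftrightarrow> x \<in> R" for x
      using Rc R(2) by (auto simp: conj_set_iff conj_set_carrier m_assoc inv_cancel)
    then show ?thesis by (auto simp: R(3))
  qed
  have q: "mon_conj G (inv g) p \<in> mon_pairs G A" using p R by (intro mon_conj_pairs) auto
  have "fst (mon_conj G (inv g) p) = R" by (simp add: fst_mon_conj conj_back)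
  then have e: "mon_conj G (inv g) p = (R, snd (mon_conj G (inv g) p))" by (metis prod.collapse)
  have "snd (mon_conj G (inv g) p) \<in> Hom_set G A R" using q by (subst (asm) e) (auto simp: mon_pairs_def)
  moreover have "U = mon_orbit G (R, snd (mon_conj G (inv g) p))"
    using mon_orbit_conj [OF pairs_subset [OF p(1)], of "inv g"] R(2) p(2) by (simp add: e [symmetric])
  ultimately show ?thesis using that R(1) by blast
qed

text \<open>
  Among the orbits in the support of \<open>x\<close> take one, \<open>[K, \<phi>]\<close>, with \<open>K\<close> of maximal order. No other
  orbit of the support contributes to the coefficient at \<open>\<phi>\<close> of the ghost at \<open>K\<close>.
\<close>

lemma ghost_map_jointly_injective:
  assumes S: "subgroup_class_reps G S" and x: "x \<in> carrier (burnside_ring A G)"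
    and zero: "\<And>K. K \<in> S \<Longrightarrow> ghost_map K x = 0"
  shows "x = 0"
proof (rule ccontr)
  assume "x \<noteq> 0"
  define size where "size U = card (fst (SOME q. q \<in> U))" for U :: "('a set \<times> ('a \<Rightarrow> 'c)) set"
  have "Poly_Mapping.keys x \<noteq> {}" using \<open>x \<noteq> 0\<close> by simp
  then have "Max (size ` Poly_Mapping.keys x) \<in> size ` Poly_Mapping.keys x" by (intro Max_in) auto
  then obtain U where U: "U \<in> Poly_Mapping.keys x" "size U = Max (size ` Poly_Mapping.keys x)" by auto
  have max: "size V \<le> size U" if "V \<in> Poly_Mapping.keys x" for V
    using that unfolding U(2) by (intro Max_ge) auto
  have orb: "V \<in> mon_orbits G A" if "V \<in> Poly_Mapping.keys x" for V
    using that x by (auto simp: carrier_burnside_iff)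
  obtain K \<phi> where K: "K \<in> S" "\<phi> \<in> Hom_set G A K" "U = mon_orbit G (K, \<phi>)"
    using orbit_rep_in_class_reps [OF S orb [OF U(1)]] .
  have p: "(K, \<phi>) \<in> mon_pairs G A" using S K by (auto simp: subgroup_class_reps_def mon_pairs_def)
  let ?rep = "\<lambda>V. SOME q. q \<in> V"
  let ?g = "\<lambda>V. mon_gamma G (K, \<phi>) (?rep V)"
  have sz: "size U = card K"
    using ghost_orbit_cong(2) [OF orbit_rep(1) [OF orb [OF U(1)]] p] orbit_rep(2) [OF orb [OF U(1)]]
    by (simp add: size_def K(3))
  have off: "?g V = 0" if V: "V \<in> Poly_Mapping.keys x" "V \<noteq> U" for V
  proof (rule ccontr)
    assume "?g V \<noteq> 0"
    then have "mon_orbit G (K, \<phi>) = mon_orbit G (?rep V)"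
      using max [OF V(1)] sz by (intro mon_orbit_eq_if_gamma p orbit_rep(1) orb V) (auto simp: size_def)
    then show False using V(2) K(3) orbit_rep(2) [OF orb [OF V(1)]] by simp
  qed
  have diag: "?g U \<noteq> 0"
    using mon_gamma_nonzero_if_orbit_eq [OF p orbit_rep(1) [OF orb [OF U(1)]]]
      orbit_rep(2) [OF orb [OF U(1)]] K(3) by simp
  have "Poly_Mapping.lookup (ghost_map K x) \<phi> =
      (\<Sum>V\<in>Poly_Mapping.keys x. Poly_Mapping.lookup x V * int (?g V))"
    unfolding ghost_map_def lookup_frag_extend
    by (rule sum.cong [OF refl]) (simp add: lookup_ghost [OF orbit_rep(1) [OF orb]])
  also have "\<dots> = (\<Sum>V\<in>{U}. Poly_Mapping.lookup x V * int (?g V))"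
    using U(1) off by (intro sum.mono_neutral_right) auto
  also have "\<dots> \<noteq> 0" using U(1) diag by (simp add: in_keys_iff)
  finally show False using zero [OF K(1)] by simp
qed

end

section \<open>Transport along a bijection of bases\<close>

lemma bij_betw_frag_extend:
  assumes T: "bij_betw T S S'"
  shows "bij_betw (frag_extend (\<lambda>U. frag_of (T U))) {x. Poly_Mapping.keys x \<subseteq> S} {x. Poly_Mapping.keys x \<subseteq> S'}"
proof -
  have inverse: "frag_extend (\<lambda>V. frag_of (g V)) (frag_extend (\<lambda>U. frag_of (f U)) x) = x"
    if "Poly_Mapping.keys x \<subseteq> R" "\<And>U. U \<in> R \<Longrightarrow> g (f U) = U" for f :: "'u \<Rightarrow> 'v" and g R x
  proof -
    have "frag_extend (\<lambda>V. frag_of (g V)) (frag_extend (\<lambda>U. frag_of (f U)) x) = frag_extend frag_of x"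
      using that by (auto simp: frag_extend_extend intro!: frag_extend_eq)
    then show ?thesis by (simp add: frag_expansion [symmetric])
  qed
  have keys: "Poly_Mapping.keys (frag_extend (\<lambda>U. frag_of (f U)) x) \<subseteq> R'"
    if "Poly_Mapping.keys x \<subseteq> R" "f ` R \<subseteq> R'" for f :: "'u \<Rightarrow> 'v" and R R' x
    using that by (intro order_trans [OF keys_frag_extend]) auto
  show ?thesis
  proof (rule bij_betw_byWitness [where f' = "frag_extend (\<lambda>V. frag_of (inv_into S T V))"], goal_cases)
    case 1
    then show ?case using inverse bij_betw_inv_into_left [OF T] by blast
  next
    case 2
    then show ?case using inverse bij_betw_inv_into_right [OF T] by blast
  next
    case 3
    show ?case by (clarify, rule subsetD [OF keys]) (use bij_betwE [OF T] in auto)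
  next
    case 4
    show ?case
      by (clarify, rule subsetD [OF keys]) (use bij_betwE [OF bij_betw_inv_into [OF T]] in auto)
  qed
qed

theorem proposition2p5:
  fixes A :: "('c, 'n) monoid_scheme"
    and G :: "('a, 'm) monoid_scheme"
    and H :: "('b, 'k) monoid_scheme"
    and SG :: "'a set set" and SH :: "'b set set"
    and \<theta>S :: "'a set \<Rightarrow> 'b set"
    and \<theta> :: "'a set \<Rightarrow> ('a \<Rightarrow> 'c) \<Rightarrow> ('b \<Rightarrow> 'c)"
  assumes "comm_group A"
    and "group G" and "finite (carrier G)"
    and "group H" and "finite (carrier H)"
    and "subgroup_class_reps G SG"
    and "subgroup_class_reps H SH"
    and "bij_betw \<theta>S SG SH"
    and "\<And>K. K \<in> SG \<Longrightarrow> \<theta> K \<in> iso (Hom_group G A K) (Hom_group H A (\<theta>S K))"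
    and "\<And>K L \<phi> \<psi>. \<lbrakk>K \<in> SG; L \<in> SG; \<phi> \<in> Hom_set G A K; \<psi> \<in> Hom_set G A L\<rbrakk> \<Longrightarrow>
           mon_gamma H (\<theta>S K, \<theta> K \<phi>) (\<theta>S L, \<theta> L \<psi>) = mon_gamma G (K, \<phi>) (L, \<psi>)"
  shows "\<exists>\<Theta>. species_iso A G H \<Theta> \<and>
           (\<forall>K\<in>SG. \<forall>\<phi>\<in>Hom_set G A K.
              \<Theta> (frag_of (mon_orbit G (K, \<phi>))) = frag_of (mon_orbit H (\<theta>S K, \<theta> K \<phi>)))"
proof -
  interpret G: fibered G A by (intro fibered.intro fibered_axioms.intro assms(1-3))
  interpret H: fibered H A by (intro fibered.intro fibered_axioms.intro assms(1,4,5))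
  let ?BG = "burnside_ring A G" and ?BH = "burnside_ring A H"
  define P where "P p = (\<theta>S (fst p), \<theta> (fst p) (snd p))" for p
  \<comment> \<open>representatives of all orbits, several for one orbit in general: \<open>\<phi>\<close> may be moved by the normaliser of \<open>K\<close>\<close>
  define R where "R = {p \<in> mon_pairs G A. fst p \<in> SG}"
  have SG: "subgroup K G" if "K \<in> SG" for K using that assms(6) by (auto simp: subgroup_class_reps_def)
  have SH: "subgroup K H" if "K \<in> SH" for K using that assms(7) by (auto simp: subgroup_class_reps_def)
  have \<theta>S: "\<theta>S K \<in> SH" if "K \<in> SG" for K using that assms(8) by (auto dest: bij_betwE)
  have \<theta>_bij: "bij_betw (\<theta> K) (Hom_set G A K) (Hom_set H A (\<theta>S K))" if "K \<in> SG" for K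
    using assms(9) [OF that] by (simp add: iso_def Hom_group_def)
  have \<theta>_mult: "\<theta> K (\<phi> \<otimes>\<^bsub>Hom_group G A K\<^esub> \<psi>) = \<theta> K \<phi> \<otimes>\<^bsub>Hom_group H A (\<theta>S K)\<^esub> \<theta> K \<psi>"
    if "K \<in> SG" "\<phi> \<in> carrier (Hom_group G A K)" "\<psi> \<in> carrier (Hom_group G A K)" for K \<phi> \<psi>
    using assms(9) [OF that(1)] that by (auto simp: iso_def hom_def)
  \<comment> \<open>the image of the trivial homomorphism is idempotent, so its values are trivial\<close>
  have \<theta>_one: "\<theta> K (\<lambda>x\<in>K. \<one>\<^bsub>A\<^esub>) = (\<lambda>x\<in>\<theta>S K. \<one>\<^bsub>A\<^esub>)" if K: "K \<in> SG" for K
  proof -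
    let ?e = "\<lambda>x\<in>K. \<one>\<^bsub>A\<^esub>"
    have e: "?e \<in> Hom_set G A K"
      using subgroup.m_closed [OF SG [OF K]] by (auto simp: Hom_set_def hom_def)
    have "?e \<otimes>\<^bsub>Hom_group G A K\<^esub> ?e = ?e" by (auto simp: Hom_group_def fun_eq_iff)
    then have idem: "\<theta> K ?e \<otimes>\<^bsub>Hom_group H A (\<theta>S K)\<^esub> \<theta> K ?e = \<theta> K ?e"
      using \<theta>_mult [OF K, of ?e ?e] e by (simp add: Hom_group_def)
    have \<theta>e: "\<theta> K ?e \<in> Hom_set H A (\<theta>S K)" using \<theta>_bij [OF K] e by (rule bij_betw_apply)
    have "\<theta> K ?e x = \<one>\<^bsub>A\<^esub>" if x: "x \<in> \<theta>S K" for x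
    proof -
      have "\<theta> K ?e x \<in> carrier A" using \<theta>e x by (auto simp: Hom_set_def hom_def)
      moreover have "\<theta> K ?e x \<otimes>\<^bsub>A\<^esub> \<theta> K ?e x = \<theta> K ?e x"
        using fun_cong [OF idem, of x] x by (simp add: Hom_group_def)
      ultimately show ?thesis using G.A.l_cancel_one by blast
    qed
    moreover have "\<theta> K ?e \<in> extensional (\<theta>S K)" using \<theta>e by (simp add: Hom_set_def)
    ultimately show ?thesis by (auto simp: fun_eq_iff extensional_def)
  qed

  have R_iff: "(K, \<phi>) \<in> R \<longleftrightarrow> K \<in> SG \<and> \<phi> \<in> Hom_set G A K" for K \<phi>
    using SG by (auto simp: R_def mon_pairs_def)
  have R_pairs: "p \<in> mon_pairs G A" if "p \<in> R" for p using that by (simp add: R_def)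
  have P_pairs: "P p \<in> mon_pairs H A" if "p \<in> R" for p
    using that SH \<theta>S bij_betw_apply [OF \<theta>_bij] by (cases p) (auto simp: R_iff P_def mon_pairs_def)
  have gamma: "mon_gamma H (P p) (P q) = mon_gamma G p q" if "p \<in> R" "q \<in> R" for p q
    using that assms(10) by (cases p, cases q) (simp add: R_iff P_def)
  have orbit_iff: "mon_orbit H (P p) = mon_orbit H (P q) \<longleftrightarrow> mon_orbit G p = mon_orbit G q"
    if "p \<in> R" "q \<in> R" for p q
    using that by (simp add: G.mon_orbit_eq_iff_gamma H.mon_orbit_eq_iff_gamma P_pairs R_pairs gamma)
  have orbits_G: "mon_orbits G A = mon_orbit G ` R"
  proof (intro equalityI subsetI)
    fix U assume "U \<in> mon_orbits G A"
    then show "U \<in> mon_orbit G ` R" using G.orbit_rep_in_class_reps [OF assms(6)] R_iff by blast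
  qed (auto simp: mon_orbits_def R_pairs)
  have orbits_H: "mon_orbits H A = (\<lambda>p. mon_orbit H (P p)) ` R"
  proof (intro equalityI subsetI)
    fix U assume "U \<in> mon_orbits H A"
    then obtain L \<psi> where L: "L \<in> SH" "\<psi> \<in> Hom_set H A L" "U = mon_orbit H (L, \<psi>)"
      using H.orbit_rep_in_class_reps [OF assms(7)] by metis
    obtain K where K: "K \<in> SG" "L = \<theta>S K" using L(1) assms(8) by (auto simp: bij_betw_def)
    obtain \<phi> where "\<phi> \<in> Hom_set G A K" "\<psi> = \<theta> K \<phi>"
      using L(2) \<theta>_bij [OF K(1)] by (auto simp: K(2) bij_betw_def)
    then have "(K, \<phi>) \<in> R" "U = mon_orbit H (P (K, \<phi>))" using K L(3) by (auto simp: R_iff P_def)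
    then show "U \<in> (\<lambda>p. mon_orbit H (P p)) ` R" by blast
  qed (auto simp: mon_orbits_def P_pairs)

  \<comment> \<open>the bijection of bases, read off from any representative whose subgroup lies in \<open>SG\<close>\<close>
  define T where "T U = mon_orbit H (P (inv_into R (mon_orbit G) U))" for U
  have T: "T (mon_orbit G p) = mon_orbit H (P p)" if p: "p \<in> R" for p
  proof -
    have U: "mon_orbit G p \<in> mon_orbit G ` R" using p by blast
    show ?thesis
      unfolding T_def using orbit_iff [OF inv_into_into [OF U] p] f_inv_into_f [OF U] by simp
  qed
  have T_bij: "bij_betw T (mon_orbits G A) (mon_orbits H A)"
    by (auto simp: bij_betw_def orbits_G orbits_H inj_on_def T orbit_iff image_image)
  define \<Theta> where "\<Theta> = frag_extend (\<lambda>U. frag_of (T U))"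
  have \<Theta>_bij: "bij_betw \<Theta> (carrier ?BG) (carrier ?BH)"
    using bij_betw_frag_extend [OF T_bij] by (simp add: \<Theta>_def burnside_ring_def free_Abelian_group_def)
  have \<Theta>_closed: "\<Theta> x \<in> carrier ?BH" if "x \<in> carrier ?BG" for x
    using \<Theta>_bij that by (rule bij_betw_apply)
  have \<Theta>_basis: "\<Theta> (frag_of (mon_orbit G p)) = frag_of (mon_orbit H (P p))" if "p \<in> R" for p
    by (simp add: \<Theta>_def T [OF that])

  have ghost_P: "H.ghost (\<theta>S K) (P q) = frag_extend (\<lambda>\<phi>. frag_of (\<theta> K \<phi>)) (G.ghost K q)"
    if K: "K \<in> SG" and q: "q \<in> R" for K q
  proof (rule poly_mapping_eqI)
    fix \<chi>
    have keysG: "Poly_Mapping.keys (G.ghost K q) \<subseteq> Hom_set G A K"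
      by (rule G.keys_ghost [OF SG [OF K] R_pairs [OF q]])
    show "Poly_Mapping.lookup (H.ghost (\<theta>S K) (P q)) \<chi> =
        Poly_Mapping.lookup (frag_extend (\<lambda>\<phi>. frag_of (\<theta> K \<phi>)) (G.ghost K q)) \<chi>"
    proof (cases "\<chi> \<in> Hom_set H A (\<theta>S K)")
      case True
      then obtain \<phi> where \<phi>: "\<phi> \<in> Hom_set G A K" "\<chi> = \<theta> K \<phi>"
        using \<theta>_bij [OF K] by (auto simp: bij_betw_def)
      have "mon_gamma H (\<theta>S K, \<theta> K \<phi>) (P q) = mon_gamma G (K, \<phi>) q"
        using gamma [of "(K, \<phi>)" q] K \<phi> q by (simp add: R_iff P_def)
      then show ?thesis
        using lookup_frag_extend_inj [OF bij_betw_imp_inj_on [OF \<theta>_bij [OF K]] keysG \<phi>(1)]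
        by (simp add: \<phi>(2) G.lookup_ghost [OF R_pairs [OF q]] H.lookup_ghost [OF P_pairs [OF q]])
    next
      case False
      have "\<chi> \<notin> Poly_Mapping.keys (H.ghost (\<theta>S K) (P q))"
        using False H.keys_ghost [OF SH [OF \<theta>S [OF K]] P_pairs [OF q]] by blast
      moreover have "\<chi> \<noteq> \<theta> K \<phi>" if "\<phi> \<in> Poly_Mapping.keys (G.ghost K q)" for \<phi>
        using False that keysG bij_betw_apply [OF \<theta>_bij [OF K]] by blast
      ultimately show ?thesis by (simp add: lookup_frag_extend in_keys_iff)
    qed
  qed
  have ghost_\<Theta>: "H.ghost_map (\<theta>S K) (\<Theta> x) = frag_extend (\<lambda>\<phi>. frag_of (\<theta> K \<phi>)) (G.ghost_map K x)"
    if K: "K \<in> SG" and x: "x \<in> carrier ?BG" for K x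
  proof -
    have "H.ghost_map (\<theta>S K) (frag_of (T U)) = frag_extend (\<lambda>\<phi>. frag_of (\<theta> K \<phi>)) (G.ghost_map K (frag_of U))"
      if "U \<in> Poly_Mapping.keys x" for U
    proof -
      obtain q where q: "q \<in> R" "U = mon_orbit G q" using \<open>U \<in> _\<close> x by (auto simp: G.carrier_burnside_iff orbits_G)
      show ?thesis
        by (simp add: q(2) T [OF q(1)] G.ghost_map_orbit [OF R_pairs [OF q(1)]]
            H.ghost_map_orbit [OF P_pairs [OF q(1)]] ghost_P [OF K q(1)])
    qed
    then show ?thesis
      by (auto simp: \<Theta>_def G.ghost_map_def H.ghost_map_def frag_extend_extend intro!: frag_extend_eq)
  qed

  have eq_if_ghosts_eq: "x = y"
    if xy: "x \<in> carrier ?BH" "y \<in> carrier ?BH"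
      and eq: "\<And>K. K \<in> SG \<Longrightarrow> H.ghost_map (\<theta>S K) x = H.ghost_map (\<theta>S K) y"
    for x y
  proof -
    have "x - y \<in> carrier ?BH"
      using xy keys_diff [of x y] by (auto simp: H.carrier_burnside_iff)
    moreover have "H.ghost_map L (x - y) = 0" if "L \<in> SH" for L
    proof -
      obtain K where "K \<in> SG" "L = \<theta>S K" using \<open>L \<in> SH\<close> assms(8) by (auto simp: bij_betw_def)
      then show ?thesis using eq by (simp add: H.ghost_map_def frag_extend_diff)
    qed
    ultimately have "x - y = 0" by (rule H.ghost_map_jointly_injective [OF assms(7)])
    then show ?thesis by simp
  qed
  have \<Theta>_mult: "\<Theta> (x \<otimes>\<^bsub>?BG\<^esub> y) = \<Theta> x \<otimes>\<^bsub>?BH\<^esub> \<Theta> y" if x: "x \<in> carrier ?BG" and y: "y \<in> carrier ?BG" for x y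
  proof (rule eq_if_ghosts_eq)
    fix K assume K: "K \<in> SG"
    have keys: "Poly_Mapping.keys (G.ghost_map K z) \<subseteq> carrier (Hom_group G A K)" if "z \<in> carrier ?BG" for z
      using G.keys_ghost_map [OF SG [OF K] that] by (simp add: Hom_group_def)
    have "frag_extend (\<lambda>\<phi>. frag_of (\<theta> K \<phi>)) (conv (Hom_group G A K) (G.ghost_map K x) (G.ghost_map K y)) =
        conv (Hom_group H A (\<theta>S K)) (frag_extend (\<lambda>\<phi>. frag_of (\<theta> K \<phi>)) (G.ghost_map K x))
          (frag_extend (\<lambda>\<phi>. frag_of (\<theta> K \<phi>)) (G.ghost_map K y))"
      by (rule conv_image [OF keys [OF x] keys [OF y]]) (rule \<theta>_mult [OF K])
    then show "H.ghost_map (\<theta>S K) (\<Theta> (x \<otimes>\<^bsub>?BG\<^esub> y)) = H.ghost_map (\<theta>S K) (\<Theta> x \<otimes>\<^bsub>?BH\<^esub> \<Theta> y)"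
      by (simp add: ghost_\<Theta> [OF K] x y G.burnside_mult_closed G.ghost_map_mult H.ghost_map_mult \<Theta>_closed)
  qed (intro \<Theta>_closed G.burnside_mult_closed H.burnside_mult_closed x y)+
  have \<Theta>_one: "\<Theta> \<one>\<^bsub>?BG\<^esub> = \<one>\<^bsub>?BH\<^esub>"
  proof (rule eq_if_ghosts_eq)
    fix K assume K: "K \<in> SG"
    show "H.ghost_map (\<theta>S K) (\<Theta> \<one>\<^bsub>?BG\<^esub>) = H.ghost_map (\<theta>S K) \<one>\<^bsub>?BH\<^esub>"
      using G.ghost_map_one [OF subgroup.subset [OF SG [OF K]]]
        H.ghost_map_one [OF subgroup.subset [OF SH [OF \<theta>S [OF K]]]]
      by (simp add: ghost_\<Theta> [OF K] G.burnside_one_closed \<theta>_one [OF K])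
  qed (intro \<Theta>_closed G.burnside_one_closed H.burnside_one_closed)+
  have "\<Theta> \<in> ring_iso ?BG ?BH"
  proof -
    have "\<Theta> (x \<oplus>\<^bsub>?BG\<^esub> y) = \<Theta> x \<oplus>\<^bsub>?BH\<^esub> \<Theta> y" for x y
      by (simp add: burnside_ring_def \<Theta>_def frag_extend_add)
    then show ?thesis
      using \<Theta>_bij \<Theta>_closed \<Theta>_mult \<Theta>_one by (auto simp: ring_iso_def intro: ring_hom_memI)
  qed
  moreover have "\<exists>V\<in>mon_orbits H A. \<Theta> (frag_of U) = frag_of V" if "U \<in> mon_orbits G A" for U
    using that \<Theta>_basis by (auto simp: orbits_G orbits_H)
  moreover have "\<Theta> (frag_of (mon_orbit G (K, \<phi>))) = frag_of (mon_orbit H (\<theta>S K, \<theta> K \<phi>))"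
    if "K \<in> SG" "\<phi> \<in> Hom_set G A K" for K \<phi>
    using \<Theta>_basis [of "(K, \<phi>)"] that by (simp add: R_iff P_def)
  ultimately show ?thesis unfolding species_iso_def by blast
qed

end
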